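(* Let $R$ be a commutative ring with $R=2R$, and let $I$ be an ideal of $R$. Let $(P,\langle\,,\rangle)$ be a symplectic $R$-module with $P$ finitely generated projective of rank $2n$, $n\ge 1$. Let $Q=R^2\oplus P$ and let $v=(a,b,p)\in \mathrm{Um}(Q,IQ)$. Assume that for each maximal ideal $\mathfrak m$ of $R$ the alternating form $\langle\,,\rangle$ over the local ring $R_{\mathfrak m}$ corresponds, with respect to some basis of $P_{\mathfrak m}$, to an alternating matrix $\varphi_{\mathfrak m}$ such that $\varphi_{\mathfrak m}=(1\perp\varepsilon(\mathfrak m))^t\,\psi_n\,(1\perp\varepsilon(\mathfrak m))$ for some $\varepsilon(\mathfrak m)\in \mathrm{E}_{2n-1}(R_{\mathfrak m},I_{\mathfrak m})$. Then the two orbits of $v$ coincide: $$(a,b,p)\,\mathrm{ETrans}(Q,IQ)=(a,b,p)\,\mathrm{ETrans}_{\mathrm{Sp}}(Q,IQ,\langle\,,\rangle).$$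
   Context: Rings are commutative with $1$. For a group $G$ of automorphisms of a module and an element $v$, $vG$ denotes the orbit of $v$ (automorphisms are written as acting on the right). $M^*=\mathrm{Hom}_R(M,R)$. An element $q$ of a module $M$ is unimodular if $\phi(q)=1$ for some $\phi\in M^*$. $\mathrm{Um}(Q,IQ)$ is the set of unimodular elements of $Q=R\oplus(R\oplus P)$ congruent to $(1,0,0)$ modulo $IQ$. Linear case: for an $R$-module $N=R\oplus M$, the elementary transvections of $N$ are $E_x:(a,p)\mapsto(a,p+ax)$ ($x\in M$) and $E^*_\tau:(a,p)\mapsto(a+\tau(p),p)$ ($\tau\in M^*$). $\mathrm{ETrans}(N)$ is the group they generate; $\mathrm{ETrans}(IN)$ is the subgroup generated by the $E_x,E^*_\tau$ with $x\in IM$, $\tau\in IM^*$; $\mathrm{ETrans}(N,IN)$ is the normal closure of $\mathrm{ETrans}(IN)$ in $\mathrm{ETrans}(N)$. For $Q$ one uses $Q=R\oplus M$ with $M=R\oplus P$. Symplectic case: a symplectic $R$-module is a pair $(P,\langle\,,\rangle)$ with $P$ finitely generated projective of even rank and $\langle\,,\rangle:P\times P\to R$ a non-degenerate (i.e. $x\mapsto\langle x,-\rangle$ is an isomorphism $P\cong P^*$) alternating bilinear form. $Q=R^2\oplus P$ carries the form $\langle(a,b,p),(a',b',p')\rangle=ab'-ba'+\langle p,p'\rangle$. The elementary symplectic transvections of $Q$ are $\rho(q,\alpha):(a,b,p)\mapsto(a,\,b-\langle p,q\rangle-\alpha a,\,p-aq)$ and $\mu(q,\beta):(a,b,p)\mapsto(a+\langle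 p,q\rangle+\beta b,\,b,\,p-bq)$, with $q\in P$, $\alpha,\beta\in R$. $\mathrm{ETrans}_{\mathrm{Sp}}(Q,\langle\,,\rangle)$ is the group they generate; $\mathrm{ETrans}_{\mathrm{Sp}}(IQ,\langle\,,\rangle)$ is the subgroup generated by those with $q\in IP$, $\alpha,\beta\in I$; $\mathrm{ETrans}_{\mathrm{Sp}}(Q,IQ,\langle\,,\rangle)$ is the normal closure of the latter in the former. Matrices: a form corresponds to the matrix $\varphi$ w.r.t. a basis if $\langle p,q\rangle=p\varphi q^t$ in row coordinates. $\psi_n=\sum_{i=1}^n e_{2i-1,2i}-\sum_{i=1}^n e_{2i,2i-1}$. $\alpha\perp\beta$ is the block diagonal matrix. $\mathrm{E}_k(R)$ is generated by the matrices $I_k+\lambda e_{ij}$ ($i\ne j$, $\lambda\in R$), and $\mathrm{E}_k(R,I)$ is the normal closure in $\mathrm{E}_k(R)$ of the subgroup generated by those with $\lambda\in I$. $I_{\mathfrak m}=IR_{\mathfrak m}$. *)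

theory Defs
  imports
    "HOL-Algebra.Ideal"
    "HOL-Algebra.Module"
    "HOL-Algebra.Bij"
    "HOL-Algebra.Group_Action"
    "HOL-Algebra.Generated_Groups"
    "Jordan_Normal_Form.Matrix"
begin

section \<open>Modules\<close>

text \<open>The fields \<open>mult\<close> and \<open>one\<close> of a \<open>module\<close> record carry no meaning for a module and are
  left undefined.\<close>

definition self_module :: "('a, 'r) ring_scheme \<Rightarrow> ('a, 'a) module" where
  "self_module R = \<lparr>carrier = carrier R, monoid.mult = undefined, one = undefined,
     zero = \<zero>\<^bsub>R\<^esub>, add = (\<oplus>\<^bsub>R\<^esub>), smult = (\<otimes>\<^bsub>R\<^esub>)\<rparr>"

definition sum_module ::
  "('a, 'b, 'k) module_scheme \<Rightarrow> ('a, 'c, 'l) module_scheme \<Rightarrow> ('a, 'b \<times> 'c) module" where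
  "sum_module M N = \<lparr>carrier = carrier M \<times> carrier N, monoid.mult = undefined, one = undefined,
     zero = (\<zero>\<^bsub>M\<^esub>, \<zero>\<^bsub>N\<^esub>),
     add = (\<lambda>(x, y) (x', y'). (x \<oplus>\<^bsub>M\<^esub> x', y \<oplus>\<^bsub>N\<^esub> y')),
     smult = (\<lambda>a (x, y). (a \<odot>\<^bsub>M\<^esub> x, a \<odot>\<^bsub>N\<^esub> y))\<rparr>"

definition free_module :: "('a, 'r) ring_scheme \<Rightarrow> nat \<Rightarrow> ('a, nat \<Rightarrow> 'a) module" where
  "free_module R k = \<lparr>carrier = {..<k} \<rightarrow>\<^sub>E carrier R, monoid.mult = undefined, one = undefined,
     zero = (\<lambda>i\<in>{..<k}. \<zero>\<^bsub>R\<^esub>),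
     add = (\<lambda>x y. \<lambda>i\<in>{..<k}. x i \<oplus>\<^bsub>R\<^esub> y i),
     smult = (\<lambda>a x. \<lambda>i\<in>{..<k}. a \<otimes>\<^bsub>R\<^esub> x i)\<rparr>"

text \<open>Linear maps are extensional, so that equal maps are equal functions.\<close>

definition mod_hom ::
  "('a, 'r) ring_scheme \<Rightarrow> ('a, 'b, 'k) module_scheme \<Rightarrow> ('a, 'c, 'l) module_scheme \<Rightarrow> ('b \<Rightarrow> 'c) set"
  where
  "mod_hom R M N = {f \<in> carrier M \<rightarrow>\<^sub>E carrier N.
     (\<forall>x\<in>carrier M. \<forall>y\<in>carrier M. f (x \<oplus>\<^bsub>M\<^esub> y) = f x \<oplus>\<^bsub>N\<^esub> f y) \<and>
     (\<forall>a\<in>carrier R. \<forall>x\<in>carrier M. f (a \<odot>\<^bsub>M\<^esub> x) = a \<odot>\<^bsub>N\<^esub> f x)}"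

definition dual_module ::
  "('a, 'r) ring_scheme \<Rightarrow> ('a, 'b, 'k) module_scheme \<Rightarrow> ('a, 'b \<Rightarrow> 'a) module" where
  "dual_module R M = \<lparr>carrier = mod_hom R M (self_module R), monoid.mult = undefined, one = undefined,
     zero = (\<lambda>x\<in>carrier M. \<zero>\<^bsub>R\<^esub>),
     add = (\<lambda>f g. \<lambda>x\<in>carrier M. f x \<oplus>\<^bsub>R\<^esub> g x),
     smult = (\<lambda>a f. \<lambda>x\<in>carrier M. a \<otimes>\<^bsub>R\<^esub> f x)\<rparr>"

definition ideal_smult ::
  "('a, 'r) ring_scheme \<Rightarrow> 'a set \<Rightarrow> ('a, 'b, 'k) module_scheme \<Rightarrow> 'b set" where
  "ideal_smult R I M =
     \<Inter>{N. submodule N R M \<and> (\<forall>a\<in>I. \<forall>x\<in>carrier M. a \<odot>\<^bsub>M\<^esub> x \<in> N)}"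

text \<open>Finitely generated projective: a direct summand (retract) of some \<open>R\<^sup>k\<close>.\<close>

definition fg_projective :: "('a, 'r) ring_scheme \<Rightarrow> ('a, 'b, 'k) module_scheme \<Rightarrow> bool" where
  "fg_projective R M \<longleftrightarrow> (\<exists>k. \<exists>f\<in>mod_hom R M (free_module R k). \<exists>g\<in>mod_hom R (free_module R k) M.
     \<forall>x\<in>carrier M. g (f x) = x)"

definition is_basis ::
  "('a, 'r) ring_scheme \<Rightarrow> ('a, 'b, 'k) module_scheme \<Rightarrow> nat \<Rightarrow> (nat \<Rightarrow> 'b) \<Rightarrow> bool" where
  "is_basis R M k e \<longleftrightarrow> e \<in> {..<k} \<rightarrow> carrier M \<and>
     (\<forall>x\<in>carrier M. \<exists>!c. c \<in> {..<k} \<rightarrow>\<^sub>E carrier R \<and>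
        x = (\<Oplus>\<^bsub>M\<^esub>i\<in>{..<k}. c i \<odot>\<^bsub>M\<^esub> e i))"

definition unimodular :: "('a, 'r) ring_scheme \<Rightarrow> ('a, 'b, 'k) module_scheme \<Rightarrow> 'b \<Rightarrow> bool" where
  "unimodular R M q \<longleftrightarrow> q \<in> carrier M \<and> (\<exists>f\<in>carrier (dual_module R M). f q = \<one>\<^bsub>R\<^esub>)"


section \<open>Localization at a multiplicative set\<close>

text \<open>The fraction \<open>m/s\<close>, as the equivalence class of \<open>(m, s)\<close> in \<open>M \<times> S\<close>. The operations on
  classes are unions over all representatives; for a multiplicative set \<open>S\<close> all of them give the
  same class.\<close>

definition fraction ::
  "('a, 'r) ring_scheme \<Rightarrow> 'a set \<Rightarrow> ('a, 'b, 'k) module_scheme \<Rightarrow> 'b \<Rightarrow> 'a \<Rightarrow> ('b \<times> 'a) set" where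
  "fraction R S M m s = {(m', s'). m' \<in> carrier M \<and> s' \<in> S \<and>
     (\<exists>u\<in>S. u \<odot>\<^bsub>M\<^esub> (s \<odot>\<^bsub>M\<^esub> m') = u \<odot>\<^bsub>M\<^esub> (s' \<odot>\<^bsub>M\<^esub> m))}"

definition loc_module ::
  "('a, 'r) ring_scheme \<Rightarrow> 'a set \<Rightarrow> ('a, 'b, 'k) module_scheme \<Rightarrow> (('a \<times> 'a) set, ('b \<times> 'a) set) module"
  where
  "loc_module R S M = \<lparr>carrier = {fraction R S M m s | m s. m \<in> carrier M \<and> s \<in> S},
     monoid.mult = undefined, one = undefined,
     zero = fraction R S M \<zero>\<^bsub>M\<^esub> \<one>\<^bsub>R\<^esub>,
     add = (\<lambda>X Y. \<Union>(m, s)\<in>X. \<Union>(m', s')\<in>Y.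
       fraction R S M (s' \<odot>\<^bsub>M\<^esub> m \<oplus>\<^bsub>M\<^esub> s \<odot>\<^bsub>M\<^esub> m') (s \<otimes>\<^bsub>R\<^esub> s')),
     smult = (\<lambda>A X. \<Union>(a, s)\<in>A. \<Union>(m, t)\<in>X. fraction R S M (a \<odot>\<^bsub>M\<^esub> m) (s \<otimes>\<^bsub>R\<^esub> t))\<rparr>"

definition loc_ring :: "('a, 'r) ring_scheme \<Rightarrow> 'a set \<Rightarrow> ('a \<times> 'a) set ring" where
  "loc_ring R S = (let L = loc_module R S (self_module R) in
     \<lparr>carrier = carrier L, monoid.mult = smult L, one = fraction R S (self_module R) \<one>\<^bsub>R\<^esub> \<one>\<^bsub>R\<^esub>,
      zero = zero L, add = add L\<rparr>)"

definition loc_ideal :: "('a, 'r) ring_scheme \<Rightarrow> 'a set \<Rightarrow> 'a set \<Rightarrow> ('a \<times> 'a) set set" where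
  "loc_ideal R S I = genideal (loc_ring R S) ((\<lambda>a. fraction R S (self_module R) a \<one>\<^bsub>R\<^esub>) ` I)"

definition loc_form ::
  "('a, 'r) ring_scheme \<Rightarrow> 'a set \<Rightarrow> ('b \<Rightarrow> 'b \<Rightarrow> 'a) \<Rightarrow>
   ('b \<times> 'a) set \<Rightarrow> ('b \<times> 'a) set \<Rightarrow> ('a \<times> 'a) set" where
  "loc_form R S B X Y =
     (\<Union>(p, s)\<in>X. \<Union>(q, t)\<in>Y. fraction R S (self_module R) (B p q) (s \<otimes>\<^bsub>R\<^esub> t))"

definition rank_at ::
  "('a, 'r) ring_scheme \<Rightarrow> ('a, 'b, 'k) module_scheme \<Rightarrow> 'a set \<Rightarrow> nat \<Rightarrow> bool" where
  "rank_at R M \<pp> k \<longleftrightarrow>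
     (\<exists>e. is_basis (loc_ring R (carrier R - \<pp>)) (loc_module R (carrier R - \<pp>) M) k e)"

definition has_rank :: "('a, 'r) ring_scheme \<Rightarrow> ('a, 'b, 'k) module_scheme \<Rightarrow> nat \<Rightarrow> bool" where
  "has_rank R M k \<longleftrightarrow> (\<forall>\<pp>. primeideal \<pp> R \<longrightarrow> rank_at R M \<pp> k)"


section \<open>Symplectic modules\<close>

locale symplectic_module = module R P
  for R (structure) and P (structure) and B :: "'b \<Rightarrow> 'b \<Rightarrow> 'a" +
  assumes fg_projective: "fg_projective R P"
    and even_rank: "\<And>\<pp>. primeideal \<pp> R \<Longrightarrow> \<exists>k. even k \<and> rank_at R P \<pp> k"
    and form_closed: "\<And>x y. \<lbrakk>x \<in> carrier P; y \<in> carrier P\<rbrakk> \<Longrightarrow> B x y \<in> carrier R"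
    and form_add_left: "\<And>x y z. \<lbrakk>x \<in> carrier P; y \<in> carrier P; z \<in> carrier P\<rbrakk> \<Longrightarrow>
          B (x \<oplus>\<^bsub>P\<^esub> y) z = B x z \<oplus> B y z"
    and form_add_right: "\<And>x y z. \<lbrakk>x \<in> carrier P; y \<in> carrier P; z \<in> carrier P\<rbrakk> \<Longrightarrow>
          B x (y \<oplus>\<^bsub>P\<^esub> z) = B x y \<oplus> B x z"
    and form_smult_left: "\<And>a x y. \<lbrakk>a \<in> carrier R; x \<in> carrier P; y \<in> carrier P\<rbrakk> \<Longrightarrow>
          B (a \<odot>\<^bsub>P\<^esub> x) y = a \<otimes> B x y"
    and form_smult_right: "\<And>a x y. \<lbrakk>a \<in> carrier R; x \<in> carrier P; y \<in> carrier P\<rbrakk> \<Longrightarrow>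
          B x (a \<odot>\<^bsub>P\<^esub> y) = a \<otimes> B x y"
    and alternating: "\<And>x. x \<in> carrier P \<Longrightarrow> B x x = \<zero>"
    and nondegenerate:
      "bij_betw (\<lambda>x. \<lambda>y\<in>carrier P. B x y) (carrier P) (carrier (dual_module R P))"


section \<open>Transvections\<close>

definition normal_closure :: "('g, 'm) monoid_scheme \<Rightarrow> 'g set \<Rightarrow> 'g set \<Rightarrow> 'g set" where
  "normal_closure G H K = \<Inter>{N. N \<lhd> (G\<lparr>carrier := H\<rparr>) \<and> K \<subseteq> N}"

text \<open>All transvection groups are subgroups of \<open>BijGroup (carrier N)\<close>, whose elements are extensional
  functions. Its multiplication is \<open>compose\<close>, i.e. maps act on the left; reversing the order of
  composition changes neither generated subgroups nor normal closures nor orbits.\<close>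

definition lin_transv ::
  "('a, 'r) ring_scheme \<Rightarrow> ('a, 'b, 'k) module_scheme \<Rightarrow> 'b \<Rightarrow> 'a \<times> 'b \<Rightarrow> 'a \<times> 'b" where
  "lin_transv R M x =
     restrict (\<lambda>(a, p). (a, p \<oplus>\<^bsub>M\<^esub> a \<odot>\<^bsub>M\<^esub> x)) (carrier (sum_module (self_module R) M))"

definition lin_transv_dual ::
  "('a, 'r) ring_scheme \<Rightarrow> ('a, 'b, 'k) module_scheme \<Rightarrow> ('b \<Rightarrow> 'a) \<Rightarrow> 'a \<times> 'b \<Rightarrow> 'a \<times> 'b" where
  "lin_transv_dual R M \<tau> =
     restrict (\<lambda>(a, p). (a \<oplus>\<^bsub>R\<^esub> \<tau> p, p)) (carrier (sum_module (self_module R) M))"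

text \<open>In the following, \<open>M\<close> is the second summand of \<open>N = R \<oplus> M\<close>: \<open>ETrans R M\<close>,
  \<open>ETrans_ideal R M I\<close> and \<open>ETrans_rel R M I\<close> are \<open>ETrans(N)\<close>, \<open>ETrans(IN)\<close> and \<open>ETrans(N, IN)\<close>.\<close>

definition ETrans ::
  "('a, 'r) ring_scheme \<Rightarrow> ('a, 'b, 'k) module_scheme \<Rightarrow> ('a \<times> 'b \<Rightarrow> 'a \<times> 'b) set" where
  "ETrans R M = generate (BijGroup (carrier (sum_module (self_module R) M)))
     (lin_transv R M ` carrier M \<union> lin_transv_dual R M ` carrier (dual_module R M))"

definition ETrans_ideal ::
  "('a, 'r) ring_scheme \<Rightarrow> ('a, 'b, 'k) module_scheme \<Rightarrow> 'a set \<Rightarrow> ('a \<times> 'b \<Rightarrow> 'a \<times> 'b) set" where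
  "ETrans_ideal R M I = generate (BijGroup (carrier (sum_module (self_module R) M)))
     (lin_transv R M ` ideal_smult R I M \<union>
      lin_transv_dual R M ` ideal_smult R I (dual_module R M))"

definition ETrans_rel ::
  "('a, 'r) ring_scheme \<Rightarrow> ('a, 'b, 'k) module_scheme \<Rightarrow> 'a set \<Rightarrow> ('a \<times> 'b \<Rightarrow> 'a \<times> 'b) set" where
  "ETrans_rel R M I = normal_closure (BijGroup (carrier (sum_module (self_module R) M)))
     (ETrans R M) (ETrans_ideal R M I)"

definition hyp_module ::
  "('a, 'r) ring_scheme \<Rightarrow> ('a, 'b, 'k) module_scheme \<Rightarrow> ('a, 'a \<times> 'a \<times> 'b) module" where
  "hyp_module R P = sum_module (self_module R) (sum_module (self_module R) P)"

definition sp_rho ::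
  "('a, 'r) ring_scheme \<Rightarrow> ('a, 'b, 'k) module_scheme \<Rightarrow> ('b \<Rightarrow> 'b \<Rightarrow> 'a) \<Rightarrow> 'b \<Rightarrow> 'a \<Rightarrow>
   'a \<times> 'a \<times> 'b \<Rightarrow> 'a \<times> 'a \<times> 'b" where
  "sp_rho R P B q \<alpha> = restrict
     (\<lambda>(a, b, p). (a, b \<ominus>\<^bsub>R\<^esub> B p q \<ominus>\<^bsub>R\<^esub> \<alpha> \<otimes>\<^bsub>R\<^esub> a, p \<ominus>\<^bsub>P\<^esub> a \<odot>\<^bsub>P\<^esub> q))
     (carrier (hyp_module R P))"

definition sp_mu ::
  "('a, 'r) ring_scheme \<Rightarrow> ('a, 'b, 'k) module_scheme \<Rightarrow> ('b \<Rightarrow> 'b \<Rightarrow> 'a) \<Rightarrow> 'b \<Rightarrow> 'a \<Rightarrow>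
   'a \<times> 'a \<times> 'b \<Rightarrow> 'a \<times> 'a \<times> 'b" where
  "sp_mu R P B q \<beta> = restrict
     (\<lambda>(a, b, p). (a \<oplus>\<^bsub>R\<^esub> B p q \<oplus>\<^bsub>R\<^esub> \<beta> \<otimes>\<^bsub>R\<^esub> b, b, p \<ominus>\<^bsub>P\<^esub> b \<odot>\<^bsub>P\<^esub> q))
     (carrier (hyp_module R P))"

definition ETransSp ::
  "('a, 'r) ring_scheme \<Rightarrow> ('a, 'b, 'k) module_scheme \<Rightarrow> ('b \<Rightarrow> 'b \<Rightarrow> 'a) \<Rightarrow>
   ('a \<times> 'a \<times> 'b \<Rightarrow> 'a \<times> 'a \<times> 'b) set" where
  "ETransSp R P B = generate (BijGroup (carrier (hyp_module R P)))
     ({sp_rho R P B q \<alpha> | q \<alpha>. q \<in> carrier P \<and> \<alpha> \<in> carrier R} \<union>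
      {sp_mu R P B q \<beta> | q \<beta>. q \<in> carrier P \<and> \<beta> \<in> carrier R})"

definition ETransSp_ideal ::
  "('a, 'r) ring_scheme \<Rightarrow> ('a, 'b, 'k) module_scheme \<Rightarrow> ('b \<Rightarrow> 'b \<Rightarrow> 'a) \<Rightarrow> 'a set \<Rightarrow>
   ('a \<times> 'a \<times> 'b \<Rightarrow> 'a \<times> 'a \<times> 'b) set" where
  "ETransSp_ideal R P B I = generate (BijGroup (carrier (hyp_module R P)))
     ({sp_rho R P B q \<alpha> | q \<alpha>. q \<in> ideal_smult R I P \<and> \<alpha> \<in> I} \<union>
      {sp_mu R P B q \<beta> | q \<beta>. q \<in> ideal_smult R I P \<and> \<beta> \<in> I})"

definition ETransSp_rel ::
  "('a, 'r) ring_scheme \<Rightarrow> ('a, 'b, 'k) module_scheme \<Rightarrow> ('b \<Rightarrow> 'b \<Rightarrow> 'a) \<Rightarrow> 'a set \<Rightarrow>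
   ('a \<times> 'a \<times> 'b \<Rightarrow> 'a \<times> 'a \<times> 'b) set" where
  "ETransSp_rel R P B I = normal_closure (BijGroup (carrier (hyp_module R P)))
     (ETransSp R P B) (ETransSp_ideal R P B I)"

definition Um_rel ::
  "('a, 'r) ring_scheme \<Rightarrow> ('a, 'b, 'k) module_scheme \<Rightarrow> 'a set \<Rightarrow> ('a \<times> 'a \<times> 'b) set" where
  "Um_rel R P I = {v. unimodular R (hyp_module R P) v \<and>
     v \<ominus>\<^bsub>hyp_module R P\<^esub> (\<one>\<^bsub>R\<^esub>, \<zero>\<^bsub>R\<^esub>, \<zero>\<^bsub>P\<^esub>) \<in> ideal_smult R I (hyp_module R P)}"


section \<open>Matrices over a ring with carrier\<close>

text \<open>The library product of matrices needs a type class; the one below takes the ring operations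
  from the record \<open>R\<close>. Indices start at 0.\<close>

definition mat_over :: "('a, 'r) ring_scheme \<Rightarrow> nat \<Rightarrow> 'a mat set" where
  "mat_over R k = {A \<in> carrier_mat k k. elements_mat A \<subseteq> carrier R}"

definition mat_prod :: "('a, 'r) ring_scheme \<Rightarrow> 'a mat \<Rightarrow> 'a mat \<Rightarrow> 'a mat" where
  "mat_prod R A C = mat (dim_row A) (dim_col C)
     (\<lambda>(i, j). \<Oplus>\<^bsub>R\<^esub>l\<in>{..<dim_col A}. A $$ (i, l) \<otimes>\<^bsub>R\<^esub> C $$ (l, j))"

definition mat_id :: "('a, 'r) ring_scheme \<Rightarrow> nat \<Rightarrow> 'a mat" where
  "mat_id R k = mat k k (\<lambda>(i, j). if i = j then \<one>\<^bsub>R\<^esub> else \<zero>\<^bsub>R\<^esub>)"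

definition GL :: "('a, 'r) ring_scheme \<Rightarrow> nat \<Rightarrow> 'a mat monoid" where
  "GL R k = units_of \<lparr>carrier = mat_over R k, monoid.mult = mat_prod R, one = mat_id R k\<rparr>"

definition elem_mat :: "('a, 'r) ring_scheme \<Rightarrow> nat \<Rightarrow> nat \<Rightarrow> nat \<Rightarrow> 'a \<Rightarrow> 'a mat" where
  "elem_mat R k i j c =
     mat k k (\<lambda>(r, s). if r = s then \<one>\<^bsub>R\<^esub> else if r = i \<and> s = j then c else \<zero>\<^bsub>R\<^esub>)"

text \<open>The subgroup generated by the \<open>I\<^sub>k + c e\<^sub>i\<^sub>j\<close> with \<open>c \<in> J\<close>; \<open>E\<^sub>k(R)\<close> is \<open>J = carrier R\<close>.\<close>

definition elem_group :: "('a, 'r) ring_scheme \<Rightarrow> nat \<Rightarrow> 'a set \<Rightarrow> 'a mat set" where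
  "elem_group R k J = generate (GL R k)
     {elem_mat R k i j c | i j c. i < k \<and> j < k \<and> i \<noteq> j \<and> c \<in> J}"

definition elem_group_rel :: "('a, 'r) ring_scheme \<Rightarrow> nat \<Rightarrow> 'a set \<Rightarrow> 'a mat set" where
  "elem_group_rel R k I = normal_closure (GL R k) (elem_group R k (carrier R)) (elem_group R k I)"

definition mat_perp :: "('a, 'r) ring_scheme \<Rightarrow> 'a mat \<Rightarrow> 'a mat \<Rightarrow> 'a mat" where
  "mat_perp R A C = four_block_mat A (mat (dim_row A) (dim_col C) (\<lambda>_. \<zero>\<^bsub>R\<^esub>))
     (mat (dim_row C) (dim_col A) (\<lambda>_. \<zero>\<^bsub>R\<^esub>)) C"

definition psi :: "('a, 'r) ring_scheme \<Rightarrow> nat \<Rightarrow> 'a mat" where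
  "psi R n = mat (2 * n) (2 * n) (\<lambda>(i, j).
     if even i \<and> j = i + 1 then \<one>\<^bsub>R\<^esub>
     else if even j \<and> i = j + 1 then \<ominus>\<^bsub>R\<^esub> \<one>\<^bsub>R\<^esub> else \<zero>\<^bsub>R\<^esub>)"

definition alternating_mat :: "('a, 'r) ring_scheme \<Rightarrow> nat \<Rightarrow> 'a mat \<Rightarrow> bool" where
  "alternating_mat R k A \<longleftrightarrow> A \<in> mat_over R k \<and> (\<forall>i<k. A $$ (i, i) = \<zero>\<^bsub>R\<^esub>) \<and>
     (\<forall>i<k. \<forall>j<k. A $$ (j, i) = \<ominus>\<^bsub>R\<^esub> (A $$ (i, j)))"

definition form_matrix ::
  "('a, 'r) ring_scheme \<Rightarrow> ('a, 'b, 'k) module_scheme \<Rightarrow> ('b \<Rightarrow> 'b \<Rightarrow> 'a) \<Rightarrow>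
   nat \<Rightarrow> (nat \<Rightarrow> 'b) \<Rightarrow> 'a mat \<Rightarrow> bool" where
  "form_matrix R M B k e A \<longleftrightarrow> A \<in> mat_over R k \<and>
     (\<forall>x\<in>{..<k} \<rightarrow> carrier R. \<forall>y\<in>{..<k} \<rightarrow> carrier R.
        B (\<Oplus>\<^bsub>M\<^esub>i\<in>{..<k}. x i \<odot>\<^bsub>M\<^esub> e i) (\<Oplus>\<^bsub>M\<^esub>j\<in>{..<k}. y j \<odot>\<^bsub>M\<^esub> e j) =
        (\<Oplus>\<^bsub>R\<^esub>i\<in>{..<k}. \<Oplus>\<^bsub>R\<^esub>j\<in>{..<k}. x i \<otimes>\<^bsub>R\<^esub> A $$ (i, j) \<otimes>\<^bsub>R\<^esub> y j))"

definition locally_standard_at ::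
  "('a, 'r) ring_scheme \<Rightarrow> 'a set \<Rightarrow> ('a, 'b, 'k) module_scheme \<Rightarrow> ('b \<Rightarrow> 'b \<Rightarrow> 'a) \<Rightarrow> nat \<Rightarrow>
   'a set \<Rightarrow> bool" where
  "locally_standard_at R I P B n \<mm> \<longleftrightarrow>
     (let S = carrier R - \<mm>; R\<^sub>m = loc_ring R S; P\<^sub>m = loc_module R S P in
      \<exists>e \<phi> \<epsilon>. is_basis R\<^sub>m P\<^sub>m (2 * n) e \<and> alternating_mat R\<^sub>m (2 * n) \<phi> \<and>
        form_matrix R\<^sub>m P\<^sub>m (loc_form R S B) (2 * n) e \<phi> \<and>
        \<epsilon> \<in> elem_group_rel R\<^sub>m (2 * n - 1) (loc_ideal R S I) \<and>
        \<phi> = mat_prod R\<^sub>m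
              (mat_prod R\<^sub>m (transpose_mat (mat_perp R\<^sub>m (mat_id R\<^sub>m 1) \<epsilon>)) (psi R\<^sub>m n))
              (mat_perp R\<^sub>m (mat_id R\<^sub>m 1) \<epsilon>))"

end

theory Submission
  imports Defs
begin

text \<open>Write \<open>Q = R\<^sup>2 \<oplus> P\<close>, \<open>v = (a, b, p)\<close>, and for \<open>q \<in> P\<close> let \<open>t = \<langle>p, q\<rangle>\<close>. One inclusion holds
already for the groups: \<open>\<rho>(q, \<alpha>)\<close> and \<open>\<mu>(q, \<beta>)\<close> are products of linear transvections and of
commutators of such; if \<open>q \<in> IP\<close> and \<open>\<alpha>, \<beta> \<in> I\<close>, then these transvections and one factor of each
commutator have parameters coming from \<open>I\<close> (\<open>SpI_subset_LinI\<close>).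

The converse inclusion rests on the \<^emph>\<open>shear\<close> \<open>(a, b, p) \<mapsto> (a, b + t, p)\<close>. It is linear but
in general not symplectic, and every linear transvection is composed of one shear and of symplectic transvections
(\<open>lin_via_shear\<close>). The heart of the proof is that a shear keeps every unimodular vector inside its
orbit under the elementary symplectic group. Products of \<open>\<rho>\<close> and \<open>\<mu>\<close> along \<open>q\<close> can add
\<open>c t\<^sup>2\<close> to \<open>a\<close> or to \<open>b\<close>, can multiply both \<open>a\<close> and \<open>b\<close> by \<open>1 + c t\<close>, and can
multiply \<open>a\<close> by \<open>1 - c t\<close> and \<open>b\<close> by \<open>1 + c t\<close>. The last two together turn \<open>b\<close> into
\<open>b + 2 c t b\<close>, up to multiples of \<open>t\<^sup>2\<close> which the first kind of move removes; since \<open>2\<close> is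
invertible, \<open>b\<close> may be replaced by \<open>b + c t b\<close> for every \<open>c\<close>. Polarizing the
squares, every \<open>t \<langle>p, z\<rangle>\<close> can be added to \<open>b\<close>, and \<open>\<rho>(0, \<cdot>)\<close> adds multiples of \<open>a\<close>. Now
unimodularity gives \<open>1 = \<alpha> a + \<beta> b + \<langle>p, z\<rangle>\<close>, hence
\<open>t = \<alpha> t a + \<beta> t b + t \<langle>p, z\<rangle>\<close>, and each of the three summands may be added to \<open>b\<close>
(\<open>same_orbit_shear\<close>).

The relative group \<open>ETrans(Q, IQ)\<close> is a normal closure, so conjugates \<open>g h g\<^sup>-\<^sup>1\<close> have to be
applied to \<open>v\<close>, and \<open>g\<^sup>-\<^sup>1 v\<close> need not be congruent to \<open>(1, 0, 0)\<close>. Therefore all unimodular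
vectors are considered, with the relation \<^emph>\<open>to lie in the same orbit of\<close> \<open>ETrans\<^sub>S\<^sub>p(Q, IQ)\<close>. Two
words in the \<open>\<rho>\<close> and \<open>\<mu>\<close> with congruent parameters modulo \<open>I\<close> differ by an element of this
group. The word replacing a shear at \<open>v\<close> is a polynomial expression in \<open>v\<close>, \<open>q\<close> and the dual
vector \<open>w\<close> with \<open>\<langle>v, w\<rangle> = 1\<close>; if \<open>u = g v\<close> with \<open>g\<close> in the relative group, then \<open>g w\<close> is
a dual vector of \<open>u\<close> and congruent to \<open>w\<close>, as \<open>g\<close> is an isometry and the identity modulo \<open>I\<close>.
Hence linear transvections permute the orbits of unimodular vectors (\<open>same_orbit_lin\<close>), and those
with parameters in \<open>I\<close>, being congruent to the identity, fix every orbit. The elements of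
\<open>ETrans(Q)\<close> which fix all orbits form a normal subgroup, so it contains \<open>ETrans(Q, IQ)\<close>
(\<open>LinI_same_orbit\<close>).

The computations for two congruent vectors at once are single computations in the ring of pairs
\<open>(x, y)\<close> with \<open>x - y \<in> I\<close>.\<close>

section \<open>Moves along a line\<close>

text \<open>The symplectic transvections with parameter a multiple of one vector \<open>q\<close> move \<open>(a, b, p + x q)\<close>
to a vector of the same shape, and \<open>\<langle>p + x q, q\<rangle> = \<langle>p, q\<rangle>\<close> stays constant because the form is
alternating. So only the scalars \<open>(a, b, x)\<close> and \<open>t = \<langle>p, q\<rangle>\<close> matter. A set \<open>X\<close> of such triples
that is closed under these moves stands for an orbit, or, over a ring of pairs, for the relation
between two vectors that are moved in parallel.\<close>

locale scalar_states = cring K for K (structure) +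
  fixes t h :: 'a and X :: "('a \<times> 'a \<times> 'a) set"
  assumes t_closed [simp, intro]: "t \<in> carrier K"
    and h_closed [simp, intro]: "h \<in> carrier K"
    and half: "h \<oplus> h = \<one>"
    and states: "X \<subseteq> carrier K \<times> carrier K \<times> carrier K"
    and rho: "\<lbrakk>(a, b, x) \<in> X; y \<in> carrier K; \<alpha> \<in> carrier K\<rbrakk> \<Longrightarrow>
          (a, b \<ominus> y \<otimes> t \<ominus> \<alpha> \<otimes> a, x \<ominus> a \<otimes> y) \<in> X"
    and mu: "\<lbrakk>(a, b, x) \<in> X; y \<in> carrier K; \<beta> \<in> carrier K\<rbrakk> \<Longrightarrow>
          (a \<oplus> y \<otimes> t \<oplus> \<beta> \<otimes> b, b, x \<ominus> b \<otimes> y) \<in> X"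
begin

lemma in_carrier:
  assumes "(a, b, x) \<in> X" shows "a \<in> carrier K" "b \<in> carrier K" "x \<in> carrier K"
  using assms states by auto

lemma replace:
  assumes "(a, b, x) \<in> X" "a = a'" "b = b'" "x = x'" shows "(a', b', x') \<in> X"
  using assms by simp

lemma add_multiple_to_snd:
  assumes X: "(a, b, x) \<in> X" and c: "c \<in> carrier K"
  shows "(a, b \<oplus> c \<otimes> a, x) \<in> X"
proof -
  note closed [simp] = in_carrier[OF X] c t_closed h_closed
  show ?thesis
    by (rule replace[OF rho[OF X, of \<zero> "\<ominus> c"]]) (use closed in algebra)+
qed

lemma add_multiple_to_fst:
  assumes X: "(a, b, x) \<in> X" and c: "c \<in> carrier K"
  shows "(a \<oplus> c \<otimes> b, b, x) \<in> X"
proof -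
  note closed [simp] = in_carrier[OF X] c t_closed h_closed
  show ?thesis
    by (rule replace[OF mu[OF X, of \<zero> c]]) (use closed in algebra)+
qed

text \<open>The commutator of \<open>\<rho>(h c q, 0)\<close> and \<open>\<mu>(q, 0)\<close> is the long root transvection
\<open>p \<mapsto> p + c \<langle>p, q\<rangle> q\<close> of \<open>P\<close>: the coefficient \<open>h c\<close> enters twice, once from each of the two
coordinates \<open>a\<close> and \<open>b\<close>, which is why \<open>2\<close> has to be invertible.\<close>

lemma long_root:
  assumes X: "(a, b, x) \<in> X" and c: "c \<in> carrier K"
  shows "(a, b, x \<oplus> c \<otimes> t) \<in> X"
proof -
  note closed [simp] = in_carrier[OF X] c t_closed h_closed
  have hct: "h \<otimes> c \<otimes> t \<oplus> h \<otimes> c \<otimes> t = c \<otimes> t"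
  proof -
    have "h \<otimes> c \<otimes> t \<oplus> h \<otimes> c \<otimes> t = (h \<oplus> h) \<otimes> (c \<otimes> t)"
      by (simp only: l_distr m_assoc assms h_closed t_closed m_closed)
    then show ?thesis by (simp add: half)
  qed
  from rho[OF X, of "h \<otimes> c" \<zero>]
  have "(a, b \<ominus> h \<otimes> c \<otimes> t, x \<ominus> a \<otimes> (h \<otimes> c)) \<in> X" by (simp add: a_minus_def)
  from mu[OF this, of \<one> \<zero>]
  have "(a \<oplus> t, b \<ominus> h \<otimes> c \<otimes> t, x \<ominus> a \<otimes> (h \<otimes> c) \<ominus> (b \<ominus> h \<otimes> c \<otimes> t)) \<in> X"
    by simp
  from rho[OF this, of "\<ominus> (h \<otimes> c)" \<zero>]
  have "(a \<oplus> t, b, x \<ominus> b \<oplus> (h \<otimes> c \<otimes> t \<oplus> h \<otimes> c \<otimes> t)) \<in> X"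
    by (rule replace) (use closed in algebra)+
  from mu[OF this, of "\<ominus> \<one>" \<zero>]
  show ?thesis unfolding hct
    by (rule replace) (use closed in algebra)+
qed

text \<open>A single transvection adds \<open>z t\<^sup>2\<close> to one coordinate if its parameter is itself a multiple of \<open>t\<close>;
its side effect on \<open>p\<close> is then a multiple of \<open>t q\<close> and is undone by a long root transvection.\<close>

lemma add_square_to_snd:
  assumes X: "(a, b, x) \<in> X" and z: "z \<in> carrier K"
  shows "(a, b \<oplus> z \<otimes> (t \<otimes> t), x) \<in> X"
proof -
  note closed [simp] = in_carrier[OF X] z t_closed h_closed
  from rho[OF X, of "\<ominus> (z \<otimes> t)" \<zero>]
  have "(a, b \<oplus> z \<otimes> (t \<otimes> t), x \<oplus> a \<otimes> z \<otimes> t) \<in> X"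
    by (rule replace) (use closed in algebra)+
  from long_root[OF this, of "\<ominus> (a \<otimes> z)"]
  show ?thesis by (rule replace) (use closed in algebra)+
qed

lemma add_square_to_fst:
  assumes X: "(a, b, x) \<in> X" and z: "z \<in> carrier K"
  shows "(a \<oplus> z \<otimes> (t \<otimes> t), b, x) \<in> X"
proof -
  note closed [simp] = in_carrier[OF X] z t_closed h_closed
  from mu[OF X, of "z \<otimes> t" \<zero>]
  have "(a \<oplus> z \<otimes> (t \<otimes> t), b, x \<ominus> b \<otimes> z \<otimes> t) \<in> X"
    by (rule replace) (use closed in algebra)+
  from long_root[OF this, of "b \<otimes> z"]
  show ?thesis by (rule replace) (use closed in algebra)+
qed

text \<open>This is the transvection \<open>y \<mapsto> y + c (\<langle>y, q\<rangle> l + \<langle>y, l\<rangle> q)\<close> for \<open>l = (a, b, 0)\<close>, evaluated at a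
vector whose first two coordinates are those of \<open>l\<close> and which is therefore orthogonal to \<open>l\<close>.\<close>

lemma scale_both:
  assumes X: "(a, b, x) \<in> X" and c: "c \<in> carrier K"
  shows "(a \<otimes> (\<one> \<oplus> c \<otimes> t), b \<otimes> (\<one> \<oplus> c \<otimes> t), x) \<in> X"
proof -
  note closed [simp] = in_carrier[OF X] c t_closed h_closed
  from mu[OF X, of "c \<otimes> a" \<zero>]
  have "(a \<otimes> (\<one> \<oplus> c \<otimes> t), b, x \<ominus> b \<otimes> (c \<otimes> a)) \<in> X"
    by (rule replace) (use closed in algebra)+
  from rho[OF this, of "\<ominus> (c \<otimes> b)" \<zero>]
  have "(a \<otimes> (\<one> \<oplus> c \<otimes> t), b \<otimes> (\<one> \<oplus> c \<otimes> t), x \<oplus> c \<otimes> c \<otimes> a \<otimes> b \<otimes> t) \<in> X"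
    by (rule replace) (use closed in algebra)+
  from long_root[OF this, of "\<ominus> (c \<otimes> c \<otimes> a \<otimes> b)"]
  show ?thesis by (rule replace) (use closed in algebra)+
qed

text \<open>Conjugating \<open>(a, b) \<mapsto> (a, b + c t a)\<close> by \<open>(a, b) \<mapsto> (a + b, b)\<close> gives a matrix that is
congruent to the identity modulo \<open>t\<close>. Clearing its entries off the diagonal leaves, up to multiples
of \<open>t\<^sup>2\<close>, the diagonal matrix with entries \<open>1 - c t\<close> and \<open>1 + c t\<close>.\<close>

lemma scale_opposite:
  assumes X: "(a, b, x) \<in> X" and c: "c \<in> carrier K"
  shows "(a \<otimes> (\<one> \<ominus> c \<otimes> t), b \<otimes> (\<one> \<oplus> c \<otimes> t), x) \<in> X"
proof -
  note closed [simp] = in_carrier[OF X] c t_closed h_closed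
  let ?ct = "c \<otimes> t"
  from add_multiple_to_fst[OF X, of \<one>] have "(a \<oplus> b, b, x) \<in> X" by simp
  from add_multiple_to_snd[OF this, of ?ct]
  have "(a \<oplus> b, b \<oplus> ?ct \<otimes> (a \<oplus> b), x) \<in> X" by simp
  \<comment> \<open>The summand \<open>- \<one>\<close> finishes the conjugation, \<open>?ct\<close> clears the entry off the diagonal.\<close>
  from add_multiple_to_fst[OF this, of "?ct \<ominus> \<one>"]
  have "(a \<otimes> (\<one> \<ominus> ?ct) \<oplus> c \<otimes> c \<otimes> (a \<oplus> b) \<otimes> (t \<otimes> t), b \<oplus> ?ct \<otimes> (a \<oplus> b), x) \<in> X"
    by (rule replace) (use closed in algebra)+
  from add_square_to_fst[OF this, of "\<ominus> (c \<otimes> c \<otimes> (a \<oplus> b))"]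
  have "(a \<otimes> (\<one> \<ominus> ?ct), b \<oplus> ?ct \<otimes> (a \<oplus> b), x) \<in> X"
    by (rule replace) (use closed in algebra)+
  from add_multiple_to_snd[OF this, of "\<ominus> ?ct"]
  have "(a \<otimes> (\<one> \<ominus> ?ct), b \<otimes> (\<one> \<oplus> ?ct) \<oplus> c \<otimes> c \<otimes> a \<otimes> (t \<otimes> t), x) \<in> X"
    by (rule replace) (use closed in algebra)+
  from add_square_to_snd[OF this, of "\<ominus> (c \<otimes> c \<otimes> a)"]
  show ?thesis by (rule replace) (use closed in algebra)+
qed

text \<open>The two scalings by \<open>1 \<plusminus> c t / 2\<close> cancel in \<open>a\<close> and add up in \<open>b\<close>, apart from terms in \<open>t\<^sup>2\<close>.\<close>

lemma scale_snd:
  assumes X: "(a, b, x) \<in> X" and c: "c \<in> carrier K"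
  shows "(a, b \<oplus> c \<otimes> b \<otimes> t, x) \<in> X"
proof -
  note closed [simp] = in_carrier[OF X] c t_closed h_closed
  let ?d = "h \<otimes> c"
  have d: "?d \<otimes> b \<otimes> t \<oplus> ?d \<otimes> b \<otimes> t = c \<otimes> b \<otimes> t"
  proof -
    have "?d \<otimes> b \<otimes> t \<oplus> ?d \<otimes> b \<otimes> t = (h \<oplus> h) \<otimes> (c \<otimes> b \<otimes> t)"
      by (simp add: l_distr m_assoc)
    then show ?thesis by (simp add: half)
  qed
  from scale_both[OF scale_opposite[OF X, of ?d], of ?d]
  have "(a \<ominus> ?d \<otimes> ?d \<otimes> a \<otimes> (t \<otimes> t),
         b \<oplus> (?d \<otimes> b \<otimes> t \<oplus> ?d \<otimes> b \<otimes> t) \<oplus> ?d \<otimes> ?d \<otimes> b \<otimes> (t \<otimes> t), x) \<in> X"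
    by (rule replace) (use closed in algebra)+
  from add_square_to_fst[OF this, of "?d \<otimes> ?d \<otimes> a"]
  have "(a, b \<oplus> (?d \<otimes> b \<otimes> t \<oplus> ?d \<otimes> b \<otimes> t) \<oplus> ?d \<otimes> ?d \<otimes> b \<otimes> (t \<otimes> t), x) \<in> X"
    by (rule replace) (use closed in algebra)+
  from add_square_to_snd[OF this, of "\<ominus> (?d \<otimes> ?d \<otimes> b)"]
  show ?thesis unfolding d by (rule replace) (use closed in algebra)+
qed

end

section \<open>Pairs of congruent elements\<close>

text \<open>The fibre product of \<open>R\<close> with itself over \<open>R/I\<close>. A move of a triple over this ring is a pair of
moves over \<open>R\<close> whose parameters are congruent modulo \<open>I\<close>.\<close>

definition congruent_pairs :: "('a, 'r) ring_scheme \<Rightarrow> 'a set \<Rightarrow> ('a \<times> 'a) ring" where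
  "congruent_pairs R I = \<lparr>carrier = {(x, y). x \<in> carrier R \<and> y \<in> carrier R \<and> x \<ominus>\<^bsub>R\<^esub> y \<in> I},
     monoid.mult = (\<lambda>(x, y) (x', y'). (x \<otimes>\<^bsub>R\<^esub> x', y \<otimes>\<^bsub>R\<^esub> y')), one = (\<one>\<^bsub>R\<^esub>, \<one>\<^bsub>R\<^esub>),
     zero = (\<zero>\<^bsub>R\<^esub>, \<zero>\<^bsub>R\<^esub>), add = (\<lambda>(x, y) (x', y'). (x \<oplus>\<^bsub>R\<^esub> x', y \<oplus>\<^bsub>R\<^esub> y'))\<rparr>"

locale relative = cring R + ideal I R for R (structure) and I
begin

definition cong :: "'a \<Rightarrow> 'a \<Rightarrow> bool" where
  "cong x y \<longleftrightarrow> x \<in> carrier R \<and> y \<in> carrier R \<and> x \<ominus> y \<in> I"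

lemma cong_closed: assumes "cong x y" shows "x \<in> carrier R" "y \<in> carrier R"
  using assms by (auto simp: cong_def)

lemma cong_refl [simp, intro]: "x \<in> carrier R \<Longrightarrow> cong x x"
  by (simp add: cong_def minus_eq r_neg)

lemma cong_add:
  assumes "cong x x'" "cong y y'" shows "cong (x \<oplus> y) (x' \<oplus> y')"
proof -
  have closed: "x \<in> carrier R" "x' \<in> carrier R" "y \<in> carrier R" "y' \<in> carrier R"
    using assms by (auto simp: cong_def)
  have "x \<oplus> y \<ominus> (x' \<oplus> y') = (x \<ominus> x') \<oplus> (y \<ominus> y')"
    using closed by algebra
  then show ?thesis using assms by (auto simp: cong_def)
qed

lemma cong_mult:
  assumes "cong x x'" "cong y y'" shows "cong (x \<otimes> y) (x' \<otimes> y')"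
proof -
  have closed: "x \<in> carrier R" "x' \<in> carrier R" "y \<in> carrier R" "y' \<in> carrier R"
    using assms by (auto simp: cong_def)
  have "x \<otimes> y \<ominus> x' \<otimes> y' = x \<otimes> (y \<ominus> y') \<oplus> (x \<ominus> x') \<otimes> y'"
    using closed by algebra
  then show ?thesis using assms by (simp add: cong_def I_l_closed I_r_closed)
qed

lemma cong_minus:
  assumes "cong x x'" shows "cong (\<ominus> x) (\<ominus> x')"
proof -
  have closed: "x \<in> carrier R" "x' \<in> carrier R"
    using assms by (auto simp: cong_def)
  have "\<ominus> x \<ominus> \<ominus> x' = \<ominus> (x \<ominus> x')"
    using closed by algebra
  then show ?thesis using assms by (auto simp: cong_def)
qed

lemma cong_diff: "\<lbrakk>cong x x'; cong y y'\<rbrakk> \<Longrightarrow> cong (x \<ominus> y) (x' \<ominus> y')"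
  unfolding minus_eq by (intro cong_add cong_minus)

lemma cong_sym: "cong x y \<Longrightarrow> cong y x"
proof -
  assume xy: "cong x y"
  then have closed: "x \<in> carrier R" "y \<in> carrier R" by (auto simp: cong_def)
  have "y \<ominus> x = \<ominus> (x \<ominus> y)"
    using closed by algebra
  then show ?thesis using xy by (auto simp: cong_def)
qed

lemma cong_trans:
  assumes "cong x y" "cong y z" shows "cong x z"
proof -
  have closed: "x \<in> carrier R" "y \<in> carrier R" "z \<in> carrier R"
    using assms by (auto simp: cong_def)
  have "x \<ominus> z = (x \<ominus> y) \<oplus> (y \<ominus> z)"
    using closed by algebra
  then show ?thesis using assms by (auto simp: cong_def)
qed

lemma cong_zero_iff: "x \<in> carrier R \<Longrightarrow> cong x \<zero> \<longleftrightarrow> x \<in> I"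
  by (simp add: cong_def minus_eq)

abbreviation "K \<equiv> congruent_pairs R I"

lemma congruent_pairs_simps [simp]:
  "\<one>\<^bsub>K\<^esub> = (\<one>, \<one>)" "\<zero>\<^bsub>K\<^esub> = (\<zero>, \<zero>)"
  "(x, x') \<oplus>\<^bsub>K\<^esub> (y, y') = (x \<oplus> y, x' \<oplus> y')" "(x, x') \<otimes>\<^bsub>K\<^esub> (y, y') = (x \<otimes> y, x' \<otimes> y')"
  "(x, x') \<in> carrier K \<longleftrightarrow> cong x x'"
  by (simp_all add: congruent_pairs_def cong_def)

lemma cring_congruent_pairs: "cring K"
proof (rule cringI)
  show "abelian_group K"
  proof (rule abelian_groupI)
    fix x assume "x \<in> carrier K"
    then obtain y z where "x = (y, z)" "cong y z" by (cases x) auto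
    then show "\<exists>y\<in>carrier K. y \<oplus>\<^bsub>K\<^esub> x = \<zero>\<^bsub>K\<^esub>"
      by (intro bexI[of _ "(\<ominus> y, \<ominus> z)"]) (auto simp: l_neg cong_minus cong_closed)
  qed (auto simp: cong_add cong_closed a_ac)
  show "Group.comm_monoid K"
    by (rule comm_monoidI) (auto simp: cong_mult cong_closed m_ac)
qed (auto simp: cong_closed l_distr)

lemma congruent_pairs_minus [simp]:
  assumes "cong x x'" "cong y y'"
  shows "(x, x') \<ominus>\<^bsub>K\<^esub> (y, y') = (x \<ominus> y, x' \<ominus> y')"
proof -
  interpret K: cring K by (rule cring_congruent_pairs)
  have "\<ominus>\<^bsub>K\<^esub> (y, y') = (\<ominus> y, \<ominus> y')"
    using assms by (intro K.minus_equality) (auto simp: cong_minus cong_closed l_neg)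
  then show ?thesis by (simp add: K.minus_eq minus_eq)
qed

end

section \<open>Normal closures and groups of bijections\<close>

context group
begin

lemma normal_in_subgroupI:
  assumes H: "subgroup H G" and N: "subgroup N G" "N \<subseteq> H"
    and conj: "\<And>x k. \<lbrakk>x \<in> H; k \<in> N\<rbrakk> \<Longrightarrow> x \<otimes> k \<otimes> inv x \<in> N"
  shows "N \<lhd> (G\<lparr>carrier := H\<rparr>)"
proof -
  interpret H: group "G\<lparr>carrier := H\<rparr>" by (rule subgroup_imp_group[OF H])
  show ?thesis
    using conj by (intro H.normal_invI subgroup_incl[OF N(1) H N(2)]) (simp add: H)
qed

lemma normal_in_subgroupD:
  assumes H: "subgroup H G" and N: "N \<lhd> (G\<lparr>carrier := H\<rparr>)"
  shows "subgroup N G" "N \<subseteq> H" "\<And>x k. \<lbrakk>x \<in> H; k \<in> N\<rbrakk> \<Longrightarrow> x \<otimes> k \<otimes> inv x \<in> N"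
proof -
  interpret H: group "G\<lparr>carrier := H\<rparr>" by (rule subgroup_imp_group[OF H])
  have sub: "subgroup N (G\<lparr>carrier := H\<rparr>)" using N by (rule normal_imp_subgroup)
  show "subgroup N G" by (rule incl_subgroup[OF H sub])
  show "N \<subseteq> H" using subgroup.subset[OF sub] by simp
  show "x \<otimes> k \<otimes> inv x \<in> N" if "x \<in> H" "k \<in> N" for x k
    using H.normal_invE(2)[OF N, of x k] that by (simp add: H)
qed

lemma subset_normal_closure: "K \<subseteq> normal_closure G H K"
  by (auto simp: normal_closure_def)

lemma normal_closure_least:
  "\<lbrakk>N \<lhd> (G\<lparr>carrier := H\<rparr>); K \<subseteq> N\<rbrakk> \<Longrightarrow> normal_closure G H K \<subseteq> N"
  by (auto simp: normal_closure_def)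

lemma normal_closure_normal:
  assumes H: "subgroup H G" and K: "K \<subseteq> H"
  shows "normal_closure G H K \<lhd> (G\<lparr>carrier := H\<rparr>)"
proof (rule normal_in_subgroupI[OF H])
  let ?F = "{N. N \<lhd> (G\<lparr>carrier := H\<rparr>) \<and> K \<subseteq> N}"
  note D = normal_in_subgroupD[OF H]
  have "H \<lhd> (G\<lparr>carrier := H\<rparr>)"
    by (rule normal_in_subgroupI[OF H H])
      (auto simp: subgroup.m_closed[OF H] subgroup.m_inv_closed[OF H])
  then have HF: "H \<in> ?F" using K by simp
  show "subgroup (normal_closure G H K) G"
    unfolding normal_closure_def using HF D(1) by (intro subgroups_Inter) auto
  show "normal_closure G H K \<subseteq> H"
    unfolding normal_closure_def using HF by blast
  show "x \<otimes> k \<otimes> inv x \<in> normal_closure G H K" if "x \<in> H" "k \<in> normal_closure G H K" for x k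
    using that D(3) by (auto simp: normal_closure_def)
qed

text \<open>For a generating set closed under inverses, no induction step for inverses of generators remains, so
that properties can be proved that do not pass from a map to its inverse.\<close>

lemma generate_induct_inverse_closed [consumes 1, case_names carrier inverse one gen mult]:
  assumes "g \<in> generate G S" and "S \<subseteq> carrier G" and "\<And>s. s \<in> S \<Longrightarrow> inv s \<in> S"
    and "\<Phi> \<one>" and "\<And>s. s \<in> S \<Longrightarrow> \<Phi> s"
    and "\<And>x y. \<lbrakk>x \<in> generate G S; y \<in> generate G S; \<Phi> x; \<Phi> y\<rbrakk> \<Longrightarrow> \<Phi> (x \<otimes> y)"
  shows "\<Phi> g"
  using assms(1) by (induction rule: generate.induct) (use assms in auto)

end

lemma BijGroup_simps:
  "carrier (BijGroup S) = Bij S" "x \<in> S \<Longrightarrow> \<one>\<^bsub>BijGroup S\<^esub> x = x"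
  "\<lbrakk>f \<in> Bij S; g \<in> Bij S; x \<in> S\<rbrakk> \<Longrightarrow> (f \<otimes>\<^bsub>BijGroup S\<^esub> g) x = f (g x)"
  by (auto simp: BijGroup_def compose_def)

lemma Bij_closed: "\<lbrakk>f \<in> Bij S; x \<in> S\<rbrakk> \<Longrightarrow> f x \<in> S"
  using Bij_imp_funcset by blast

lemma BijGroup_inv:
  assumes "f \<in> Bij S" "x \<in> S"
  shows "(inv\<^bsub>BijGroup S\<^esub> f) x \<in> S" "(inv\<^bsub>BijGroup S\<^esub> f) (f x) = x" "f ((inv\<^bsub>BijGroup S\<^esub> f) x) = x"
proof -
  interpret group "BijGroup S" by (rule group_BijGroup)
  have f: "f \<in> carrier (BijGroup S)" using assms by (simp add: BijGroup_simps)
  note inv = inv_closed[OF f, unfolded BijGroup_simps]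
  show "(inv\<^bsub>BijGroup S\<^esub> f) x \<in> S" using inv assms(2) by (rule Bij_closed)
  show "(inv\<^bsub>BijGroup S\<^esub> f) (f x) = x" "f ((inv\<^bsub>BijGroup S\<^esub> f) x) = x"
    using BijGroup_simps(3)[OF inv assms] BijGroup_simps(3)[OF assms(1) inv assms(2)]
      l_inv[OF f] r_inv[OF f] BijGroup_simps(2)[OF assms(2)] by auto
qed

lemma Bij_eqI: "\<lbrakk>f \<in> Bij S; g \<in> Bij S; \<And>x. x \<in> S \<Longrightarrow> f x = g x\<rbrakk> \<Longrightarrow> f = g"
  by (meson Bij_imp_extensional extensionalityI)

lemma Bij_by_inverse:
  assumes "f \<in> extensional S" "g \<in> extensional S"
    and "\<And>x. x \<in> S \<Longrightarrow> f x \<in> S" "\<And>x. x \<in> S \<Longrightarrow> g x \<in> S"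
    and "\<And>x. x \<in> S \<Longrightarrow> g (f x) = x" "\<And>x. x \<in> S \<Longrightarrow> f (g x) = x"
  shows "f \<in> Bij S" "inv\<^bsub>BijGroup S\<^esub> f = g"
proof -
  interpret group "BijGroup S" by (rule group_BijGroup)
  show f: "f \<in> Bij S"
    using assms by (auto simp: Bij_def intro!: bij_betw_byWitness[where f' = g])
  have g: "g \<in> Bij S"
    using assms by (auto simp: Bij_def intro!: bij_betw_byWitness[where f' = f])
  have "compose S g f = (\<lambda>x\<in>S. x)" using assms by (auto simp: compose_def)
  then show "inv\<^bsub>BijGroup S\<^esub> f = g"
    using f g by (intro inv_equality) (simp_all add: BijGroup_def)
qed

lemma subgroup_BijGroup:
  assumes H: "subgroup H (BijGroup S)"
  shows subgroup_Bij: "\<And>g. g \<in> H \<Longrightarrow> g \<in> Bij S"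
    and subgroup_Bij_closed: "\<And>g v. \<lbrakk>g \<in> H; v \<in> S\<rbrakk> \<Longrightarrow> g v \<in> S"
    and subgroup_Bij_apply: "\<And>g h v. \<lbrakk>g \<in> H; h \<in> H; v \<in> S\<rbrakk> \<Longrightarrow> (g \<otimes>\<^bsub>BijGroup S\<^esub> h) v = g (h v)"
    and subgroup_Bij_inv_apply:
      "\<And>g v. \<lbrakk>g \<in> H; v \<in> S\<rbrakk> \<Longrightarrow> (inv\<^bsub>BijGroup S\<^esub> g) (g v) = v"
      "\<And>g v. \<lbrakk>g \<in> H; v \<in> S\<rbrakk> \<Longrightarrow> g ((inv\<^bsub>BijGroup S\<^esub> g) v) = v"
    and subgroup_Bij_conj_apply:
      "\<And>x g v. \<lbrakk>x \<in> H; g \<in> H; v \<in> S\<rbrakk> \<Longrightarrow>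
        (x \<otimes>\<^bsub>BijGroup S\<^esub> g \<otimes>\<^bsub>BijGroup S\<^esub> inv\<^bsub>BijGroup S\<^esub> x) v = x (g ((inv\<^bsub>BijGroup S\<^esub> x) v))"
proof -
  show Bij: "g \<in> Bij S" if "g \<in> H" for g
    using subgroup.subset[OF H] that by (auto simp: BijGroup_simps)
  show closed: "g v \<in> S" if "g \<in> H" "v \<in> S" for g v
    by (rule Bij_closed[OF Bij[OF that(1)] that(2)])
  show mult: "(g \<otimes>\<^bsub>BijGroup S\<^esub> h) v = g (h v)" if "g \<in> H" "h \<in> H" "v \<in> S" for g h v
    by (rule BijGroup_simps(3)[OF Bij[OF that(1)] Bij[OF that(2)] that(3)])
  show "(inv\<^bsub>BijGroup S\<^esub> g) (g v) = v" "g ((inv\<^bsub>BijGroup S\<^esub> g) v) = v" if "g \<in> H" "v \<in> S" for g v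
    by (rule BijGroup_inv(2,3)[OF Bij[OF that(1)] that(2)])+
  show "(x \<otimes>\<^bsub>BijGroup S\<^esub> g \<otimes>\<^bsub>BijGroup S\<^esub> inv\<^bsub>BijGroup S\<^esub> x) v = x (g ((inv\<^bsub>BijGroup S\<^esub> x) v))"
    if "x \<in> H" "g \<in> H" "v \<in> S" for x g v
    by (simp only: that mult closed subgroup.m_closed[OF H] subgroup.m_inv_closed[OF H])
qed

section \<open>Sums, duals and ideal multiples of modules\<close>

lemma self_module_simps [simp]:
  "carrier (self_module R) = carrier R" "\<zero>\<^bsub>self_module R\<^esub> = \<zero>\<^bsub>R\<^esub>"
  "x \<oplus>\<^bsub>self_module R\<^esub> y = x \<oplus>\<^bsub>R\<^esub> y" "x \<odot>\<^bsub>self_module R\<^esub> y = x \<otimes>\<^bsub>R\<^esub> y"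
  by (simp_all add: self_module_def)

lemma sum_module_simps [simp]:
  "carrier (sum_module M N) = carrier M \<times> carrier N" "\<zero>\<^bsub>sum_module M N\<^esub> = (\<zero>\<^bsub>M\<^esub>, \<zero>\<^bsub>N\<^esub>)"
  "(x, y) \<oplus>\<^bsub>sum_module M N\<^esub> (x', y') = (x \<oplus>\<^bsub>M\<^esub> x', y \<oplus>\<^bsub>N\<^esub> y')"
  "a \<odot>\<^bsub>sum_module M N\<^esub> (x, y) = (a \<odot>\<^bsub>M\<^esub> x, a \<odot>\<^bsub>N\<^esub> y)"
  by (simp_all add: sum_module_def)

lemma (in cring) self_module_module: "module R (self_module R)"
proof (intro moduleI abelian_groupI is_cring)
  show "\<exists>y\<in>carrier (self_module R). y \<oplus>\<^bsub>self_module R\<^esub> x = \<zero>\<^bsub>self_module R\<^esub>"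
    if "x \<in> carrier (self_module R)" for x
    using that by (intro bexI[of _ "\<ominus> x"]) (simp_all add: l_neg)
qed (simp_all add: a_assoc m_assoc l_distr r_distr, simp add: a_comm)

lemma sum_module_module:
  assumes "module R M" "module R N" shows "module R (sum_module M N)"
proof -
  interpret M: module R M by fact
  interpret N: module R N by fact
  show ?thesis
  proof (intro moduleI abelian_groupI M.is_cring)
    fix x assume "x \<in> carrier (sum_module M N)"
    then show "\<exists>y\<in>carrier (sum_module M N). y \<oplus>\<^bsub>sum_module M N\<^esub> x = \<zero>\<^bsub>sum_module M N\<^esub>"
      by (cases x) (auto intro!: bexI[of _ "(\<ominus>\<^bsub>M\<^esub> fst x, \<ominus>\<^bsub>N\<^esub> snd x)"] simp: M.M.l_neg N.M.l_neg)
  qed (auto simp: M.M.a_ac N.M.a_ac M.smult_l_distr M.smult_r_distr N.smult_l_distr N.smult_r_distr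
      M.smult_assoc1 N.smult_assoc1)
qed

lemma dual_module_simps [simp]:
  "\<zero>\<^bsub>dual_module R M\<^esub> = (\<lambda>x\<in>carrier M. \<zero>\<^bsub>R\<^esub>)"
  "f \<oplus>\<^bsub>dual_module R M\<^esub> g = (\<lambda>x\<in>carrier M. f x \<oplus>\<^bsub>R\<^esub> g x)"
  "a \<odot>\<^bsub>dual_module R M\<^esub> f = (\<lambda>x\<in>carrier M. a \<otimes>\<^bsub>R\<^esub> f x)"
  by (simp_all add: dual_module_def)

lemma in_dual_module_iff:
  "f \<in> carrier (dual_module R M) \<longleftrightarrow> f \<in> extensional (carrier M) \<and>
     (\<forall>x\<in>carrier M. f x \<in> carrier R) \<and>
     (\<forall>x\<in>carrier M. \<forall>y\<in>carrier M. f (x \<oplus>\<^bsub>M\<^esub> y) = f x \<oplus>\<^bsub>R\<^esub> f y) \<and>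
     (\<forall>a\<in>carrier R. \<forall>x\<in>carrier M. f (a \<odot>\<^bsub>M\<^esub> x) = a \<otimes>\<^bsub>R\<^esub> f x)"
  by (auto simp: dual_module_def mod_hom_def PiE_def)

lemma (in module) dual_module_module: "module R (dual_module R M)"
proof -
  have ext: "f = g" if "f \<in> carrier (dual_module R M)" "g \<in> extensional (carrier M)"
    "\<And>x. x \<in> carrier M \<Longrightarrow> f x = g x" for f g
    using that by (auto simp: in_dual_module_iff intro: extensionalityI)
  show ?thesis
  proof (intro moduleI abelian_groupI is_cring)
    fix f assume f: "f \<in> carrier (dual_module R M)"
    show "\<exists>g\<in>carrier (dual_module R M). g \<oplus>\<^bsub>dual_module R M\<^esub> f = \<zero>\<^bsub>dual_module R M\<^esub>"
      using f by (intro bexI[of _ "\<lambda>x\<in>carrier M. \<ominus>\<^bsub>R\<^esub> f x"])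
        (auto simp: in_dual_module_iff R.l_neg R.minus_add R.r_minus intro!: restrict_ext)
    show "\<zero>\<^bsub>dual_module R M\<^esub> \<oplus>\<^bsub>dual_module R M\<^esub> f = f"
      "\<one>\<^bsub>R\<^esub> \<odot>\<^bsub>dual_module R M\<^esub> f = f"
      using f by (auto intro!: ext[symmetric, OF f] simp: in_dual_module_iff)
  qed (auto simp: in_dual_module_iff R.a_ac R.m_ac R.l_distr R.r_distr smult_closed intro!: restrict_ext)
qed

lemma (in module) ideal_smult_incl:
  assumes "ideal I R" "a \<in> I" "x \<in> carrier M" shows "a \<odot>\<^bsub>M\<^esub> x \<in> ideal_smult R I M"
  using assms by (auto simp: ideal_smult_def)

lemma ideal_smult_least:
  assumes "submodule N R M" "\<And>a x. \<lbrakk>a \<in> I; x \<in> carrier M\<rbrakk> \<Longrightarrow> a \<odot>\<^bsub>M\<^esub> x \<in> N"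
  shows "ideal_smult R I M \<subseteq> N"
  using assms by (auto simp: ideal_smult_def)

lemma (in module) submodule_zero: "submodule N R M \<Longrightarrow> \<zero>\<^bsub>M\<^esub> \<in> N"
  using subgroup.one_closed[OF submodule.axioms(1)] by fastforce

lemma (in module) ideal_smult_submodule:
  assumes "ideal I R" shows "submodule (ideal_smult R I M) R M"
proof -
  interpret ideal I R by fact
  let ?F = "{N. submodule N R M \<and> (\<forall>a\<in>I. \<forall>x\<in>carrier M. a \<odot>\<^bsub>M\<^esub> x \<in> N)}"
  have "carrier M \<in> ?F" using carrier_is_submodule Icarr by auto
  then have "\<Inter>?F \<subseteq> carrier M" by (rule Inter_lower)
  then show ?thesis
    unfolding ideal_smult_def
    by (rule submoduleI) (auto simp: submodule_zero submoduleE(3,4,5))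
qed

section \<open>The symplectic module\<close>

locale relative_symplectic = symplectic_module R P B + relative R I
  for R :: "('a, 'r) ring_scheme" (structure) and P :: "('a, 'b, 'k) module_scheme" (structure)
    and B and I
begin

lemma minus_zero_P [simp]: "\<ominus>\<^bsub>P\<^esub> \<zero>\<^bsub>P\<^esub> = \<zero>\<^bsub>P\<^esub>"
  by (simp add: M.minus_equality)

lemma alternating_sum: assumes "x \<in> carrier P" "y \<in> carrier P" shows "B x y \<oplus> B y x = \<zero>"
proof -
  have "\<zero> = B (x \<oplus>\<^bsub>P\<^esub> y) (x \<oplus>\<^bsub>P\<^esub> y)" using assms by (simp add: alternating)
  also have "\<dots> = B x x \<oplus> B y x \<oplus> (B x y \<oplus> B y y)"
    using assms by (simp only: form_add_left form_add_right M.add.m_closed)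
  finally show ?thesis using assms by (simp add: alternating form_closed R.a_comm)
qed

lemma antisymmetric: "\<lbrakk>x \<in> carrier P; y \<in> carrier P\<rbrakk> \<Longrightarrow> B y x = \<ominus> B x y"
  using alternating_sum[of y x] by (simp add: form_closed R.minus_equality)

lemma form_zero [simp]:
  assumes "x \<in> carrier P" shows "B \<zero>\<^bsub>P\<^esub> x = \<zero>" "B x \<zero>\<^bsub>P\<^esub> = \<zero>"
  using form_smult_left[of \<zero> x x] form_smult_right[of \<zero> x x] assms
  by (simp_all add: form_closed)

lemma form_minus:
  assumes "x \<in> carrier P" "y \<in> carrier P"
  shows "B (\<ominus>\<^bsub>P\<^esub> x) y = \<ominus> B x y" "B x (\<ominus>\<^bsub>P\<^esub> y) = \<ominus> B x y"
proof -
  have "B (\<ominus>\<^bsub>P\<^esub> x) y \<oplus> B x y = \<zero>"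
    using assms by (simp add: form_add_left[symmetric] M.l_neg)
  then show "B (\<ominus>\<^bsub>P\<^esub> x) y = \<ominus> B x y"
    using assms by (simp add: form_closed R.minus_equality)
  have "B x (\<ominus>\<^bsub>P\<^esub> y) \<oplus> B x y = \<zero>"
    using assms by (simp add: form_add_right[symmetric] M.l_neg)
  then show "B x (\<ominus>\<^bsub>P\<^esub> y) = \<ominus> B x y"
    using assms by (simp add: form_closed R.minus_equality)
qed

lemmas form_simps = form_closed form_add_left form_add_right form_smult_left form_smult_right
  form_minus alternating M.minus_eq

subsection \<open>Congruence of vectors\<close>

abbreviation "IP \<equiv> ideal_smult R I P"

definition pcong where
  "pcong p q \<longleftrightarrow> p \<in> carrier P \<and> q \<in> carrier P \<and> p \<ominus>\<^bsub>P\<^esub> q \<in> IP"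

lemma IP: "submodule IP R P"
  by (rule ideal_smult_submodule) (rule is_ideal)

lemmas IP_closed = submoduleE[OF IP]

lemma pcong_closed: assumes "pcong p q" shows "p \<in> carrier P" "q \<in> carrier P"
  using assms by (auto simp: pcong_def)

lemma pcong_refl [simp, intro]: "p \<in> carrier P \<Longrightarrow> pcong p p"
  using submodule_zero[OF IP] by (simp add: pcong_def M.minus_eq M.r_neg)

lemma pcong_add:
  assumes "pcong p p'" "pcong q q'" shows "pcong (p \<oplus>\<^bsub>P\<^esub> q) (p' \<oplus>\<^bsub>P\<^esub> q')"
proof -
  have "p \<oplus>\<^bsub>P\<^esub> q \<ominus>\<^bsub>P\<^esub> (p' \<oplus>\<^bsub>P\<^esub> q') = (p \<ominus>\<^bsub>P\<^esub> p') \<oplus>\<^bsub>P\<^esub> (q \<ominus>\<^bsub>P\<^esub> q')"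
    using assms by (simp add: pcong_def M.minus_eq M.minus_add M.a_ac)
  then show ?thesis using assms IP_closed(5) by (simp add: pcong_def)
qed

lemma pcong_smult:
  assumes "cong a a'" "pcong q q'" shows "pcong (a \<odot>\<^bsub>P\<^esub> q) (a' \<odot>\<^bsub>P\<^esub> q')"
proof -
  have [simp]: "a \<in> carrier R" "a' \<in> carrier R" "q \<in> carrier P" "q' \<in> carrier P"
    using assms by (auto simp: cong_def pcong_def)
  have "a \<odot>\<^bsub>P\<^esub> q \<ominus>\<^bsub>P\<^esub> a' \<odot>\<^bsub>P\<^esub> q' = a \<odot>\<^bsub>P\<^esub> (q \<ominus>\<^bsub>P\<^esub> q') \<oplus>\<^bsub>P\<^esub> (a \<ominus> a') \<odot>\<^bsub>P\<^esub> q'"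
    by (simp add: M.minus_eq R.minus_eq smult_l_distr smult_r_distr smult_l_minus smult_r_minus
        M.a_assoc M.r_neg1 M.r_neg2)
  moreover have "a \<odot>\<^bsub>P\<^esub> (q \<ominus>\<^bsub>P\<^esub> q') \<in> IP" using assms IP_closed(4) by (simp add: pcong_def)
  moreover have "(a \<ominus> a') \<odot>\<^bsub>P\<^esub> q' \<in> IP"
    using assms by (intro ideal_smult_incl is_ideal) (auto simp: cong_def)
  ultimately show ?thesis using IP_closed(5) by (simp add: pcong_def)
qed

lemma pcong_minus: "pcong q q' \<Longrightarrow> pcong (\<ominus>\<^bsub>P\<^esub> q) (\<ominus>\<^bsub>P\<^esub> q')"
  using pcong_smult[of "\<ominus> \<one>" "\<ominus> \<one>" q q'] by (simp add: smult_l_minus pcong_closed)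

lemma pcong_diff: "\<lbrakk>pcong p p'; pcong q q'\<rbrakk> \<Longrightarrow> pcong (p \<ominus>\<^bsub>P\<^esub> q) (p' \<ominus>\<^bsub>P\<^esub> q')"
  unfolding M.minus_eq by (intro pcong_add pcong_minus)

lemma pcong_trans:
  assumes "pcong p q" "pcong q r" shows "pcong p r"
proof -
  have "(p \<ominus>\<^bsub>P\<^esub> q) \<oplus>\<^bsub>P\<^esub> (q \<ominus>\<^bsub>P\<^esub> r) = p \<ominus>\<^bsub>P\<^esub> r"
    using assms by (simp add: pcong_def M.minus_eq M.a_assoc M.r_neg1 M.r_neg2)
  then show ?thesis using assms IP_closed(5)[of "p \<ominus>\<^bsub>P\<^esub> q" "q \<ominus>\<^bsub>P\<^esub> r"] by (simp add: pcong_def)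
qed

lemma pcong_sym: assumes "pcong p q" shows "pcong q p"
proof -
  have "\<ominus>\<^bsub>P\<^esub> (p \<ominus>\<^bsub>P\<^esub> q) = q \<ominus>\<^bsub>P\<^esub> p"
    using assms by (simp add: pcong_def M.minus_eq M.minus_add M.a_comm)
  then show ?thesis using assms IP_closed(3)[of "p \<ominus>\<^bsub>P\<^esub> q"] by (simp add: pcong_def)
qed

lemma pcong_zero_iff: "p \<in> carrier P \<Longrightarrow> pcong p \<zero>\<^bsub>P\<^esub> \<longleftrightarrow> p \<in> IP"
  by (simp add: pcong_def M.minus_eq M.minus_equality[of "\<zero>\<^bsub>P\<^esub>" "\<zero>\<^bsub>P\<^esub>"])

lemma form_IP: assumes "p \<in> IP" "q \<in> carrier P" shows "B p q \<in> I"
proof -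
  have "submodule {p \<in> carrier P. B p q \<in> I} R P"
    using assms(2) by (intro submoduleI) (auto simp: form_simps I_l_closed)
  then have "IP \<subseteq> {p \<in> carrier P. B p q \<in> I}"
    by (rule ideal_smult_least) (use assms(2) in \<open>auto simp: form_simps I_r_closed Icarr\<close>)
  then show ?thesis using assms by auto
qed

lemma form_cong:
  assumes "pcong p p'" "pcong q q'" shows "cong (B p q) (B p' q')"
proof -
  have [simp]: "p \<in> carrier P" "p' \<in> carrier P" "q \<in> carrier P" "q' \<in> carrier P"
    using assms by (auto simp: pcong_def)
  have "cong (B p q) (B p' q)"
    using form_IP[of "p \<ominus>\<^bsub>P\<^esub> p'" q] assms by (simp add: cong_def pcong_def form_simps M.minus_eq R.minus_eq)
  moreover have "cong (B p' q) (B p' q')"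
  proof -
    have "cong (B q p') (B q' p')"
      using form_IP[of "q \<ominus>\<^bsub>P\<^esub> q'" p'] assms
      by (simp add: cong_def pcong_def form_simps M.minus_eq R.minus_eq)
    then show ?thesis using cong_minus by (simp add: antisymmetric[of _ p'])
  qed
  ultimately show ?thesis by (rule cong_trans)
qed

lemmas cong_intros = cong_add cong_mult cong_minus cong_diff form_cong pcong_add pcong_smult
  pcong_minus pcong_diff

subsection \<open>The transvections\<close>

abbreviation "Q \<equiv> hyp_module R P"
abbreviation "\<rho> \<equiv> sp_rho R P B"
abbreviation "\<mu> \<equiv> sp_mu R P B"
abbreviation "QG \<equiv> BijGroup (carrier Q)"

lemma carrier_Q: "carrier Q = carrier R \<times> carrier R \<times> carrier P"
  by (simp add: hyp_module_def sum_module_def self_module_def)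

lemma in_Q [simp]: "(a, b, p) \<in> carrier Q \<longleftrightarrow> a \<in> carrier R \<and> b \<in> carrier R \<and> p \<in> carrier P"
  by (simp add: carrier_Q)

lemma rho_apply [simp]:
  "\<lbrakk>a \<in> carrier R; b \<in> carrier R; p \<in> carrier P\<rbrakk> \<Longrightarrow>
    \<rho> q \<alpha> (a, b, p) = (a, b \<ominus> B p q \<ominus> \<alpha> \<otimes> a, p \<ominus>\<^bsub>P\<^esub> a \<odot>\<^bsub>P\<^esub> q)"
  by (simp add: sp_rho_def)

lemma mu_apply [simp]:
  "\<lbrakk>a \<in> carrier R; b \<in> carrier R; p \<in> carrier P\<rbrakk> \<Longrightarrow>
    \<mu> q \<beta> (a, b, p) = (a \<oplus> B p q \<oplus> \<beta> \<otimes> b, b, p \<ominus>\<^bsub>P\<^esub> b \<odot>\<^bsub>P\<^esub> q)"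
  by (simp add: sp_mu_def)

lemma transv_closed:
  assumes "v \<in> carrier Q" "q \<in> carrier P" "\<alpha> \<in> carrier R"
  shows "\<rho> q \<alpha> v \<in> carrier Q" "\<mu> q \<alpha> v \<in> carrier Q"
  using assms by (cases v; simp add: form_closed)+

lemma transv_zero:
  assumes "v \<in> carrier Q" shows "\<rho> \<zero>\<^bsub>P\<^esub> \<zero> v = v" "\<mu> \<zero>\<^bsub>P\<^esub> \<zero> v = v"
  using assms by (cases v; simp add: R.minus_eq M.minus_eq)+

text \<open>The transvections \<open>\<rho>(q, \<alpha>)\<close> form a Heisenberg group: composition adds the vectors, and the central
parameter picks up the cocycle \<open>\<langle>q', q\<rangle>\<close>. In particular \<open>\<rho>(-q, -\<alpha>)\<close> is the inverse.\<close>

lemma rho_comp: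
  assumes "v \<in> carrier Q" "q \<in> carrier P" "\<alpha> \<in> carrier R" "q' \<in> carrier P" "\<alpha>' \<in> carrier R"
  shows "\<rho> q \<alpha> (\<rho> q' \<alpha>' v) = \<rho> (q \<oplus>\<^bsub>P\<^esub> q') (\<alpha> \<oplus> \<alpha>' \<ominus> B q' q) v"
proof -
  obtain a b p where v: "v = (a, b, p)" by (cases v)
  have ring: "b \<ominus> s' \<ominus> \<alpha>' \<otimes> a \<ominus> (s \<ominus> a \<otimes> r) \<ominus> \<alpha> \<otimes> a
      = b \<ominus> (s \<oplus> s') \<ominus> (\<alpha> \<oplus> \<alpha>' \<ominus> r) \<otimes> a"
    if "a \<in> carrier R" "b \<in> carrier R" "s \<in> carrier R" "s' \<in> carrier R" "r \<in> carrier R"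
      "\<alpha> \<in> carrier R" "\<alpha>' \<in> carrier R" for a b s s' r \<alpha> \<alpha>'
    using that by algebra+
  show ?thesis
    using assms ring[of a b "B p q" "B p q'" "B q' q" \<alpha> \<alpha>'] unfolding v
    by (simp add: form_simps R.minus_eq smult_r_distr M.minus_add M.a_ac)
qed

lemma mu_comp:
  assumes "v \<in> carrier Q" "q \<in> carrier P" "\<alpha> \<in> carrier R" "q' \<in> carrier P" "\<alpha>' \<in> carrier R"
  shows "\<mu> q \<alpha> (\<mu> q' \<alpha>' v) = \<mu> (q \<oplus>\<^bsub>P\<^esub> q') (\<alpha> \<oplus> \<alpha>' \<ominus> B q' q) v"
proof -
  obtain a b p where v: "v = (a, b, p)" by (cases v)
  have ring: "a \<oplus> s' \<oplus> \<alpha>' \<otimes> b \<oplus> (s \<ominus> b \<otimes> r) \<oplus> \<alpha> \<otimes> b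
      = a \<oplus> (s \<oplus> s') \<oplus> (\<alpha> \<oplus> \<alpha>' \<ominus> r) \<otimes> b"
    if "a \<in> carrier R" "b \<in> carrier R" "s \<in> carrier R" "s' \<in> carrier R" "r \<in> carrier R"
      "\<alpha> \<in> carrier R" "\<alpha>' \<in> carrier R" for a b s s' r \<alpha> \<alpha>'
    using that by algebra+
  show ?thesis
    using assms ring[of a b "B p q" "B p q'" "B q' q" \<alpha> \<alpha>'] unfolding v
    by (simp add: form_simps R.minus_eq smult_r_distr M.minus_add M.a_ac)
qed

lemma transv_cancel:
  assumes "v \<in> carrier Q" "q \<in> carrier P" "\<alpha> \<in> carrier R"
  shows "\<rho> (\<ominus>\<^bsub>P\<^esub> q) (\<ominus> \<alpha>) (\<rho> q \<alpha> v) = v" "\<rho> q \<alpha> (\<rho> (\<ominus>\<^bsub>P\<^esub> q) (\<ominus> \<alpha>) v) = v"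
    "\<mu> (\<ominus>\<^bsub>P\<^esub> q) (\<ominus> \<alpha>) (\<mu> q \<alpha> v) = v" "\<mu> q \<alpha> (\<mu> (\<ominus>\<^bsub>P\<^esub> q) (\<ominus> \<alpha>) v) = v"
  using assms
  by (simp_all add: rho_comp mu_comp form_simps R.minus_eq M.l_neg M.r_neg R.l_neg R.r_neg transv_zero)

lemma transv_Bij:
  assumes "q \<in> carrier P" "\<alpha> \<in> carrier R"
  shows "\<rho> q \<alpha> \<in> Bij (carrier Q)" "inv\<^bsub>QG\<^esub> (\<rho> q \<alpha>) = \<rho> (\<ominus>\<^bsub>P\<^esub> q) (\<ominus> \<alpha>)"
    and "\<mu> q \<alpha> \<in> Bij (carrier Q)" "inv\<^bsub>QG\<^esub> (\<mu> q \<alpha>) = \<mu> (\<ominus>\<^bsub>P\<^esub> q) (\<ominus> \<alpha>)"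
proof -
  have ext: "\<rho> q \<alpha> \<in> extensional (carrier Q)" "\<mu> q \<alpha> \<in> extensional (carrier Q)" for q \<alpha>
    by (simp_all add: sp_rho_def sp_mu_def)
  show "\<rho> q \<alpha> \<in> Bij (carrier Q)" "inv\<^bsub>QG\<^esub> (\<rho> q \<alpha>) = \<rho> (\<ominus>\<^bsub>P\<^esub> q) (\<ominus> \<alpha>)"
    using Bij_by_inverse[OF ext(1) ext(1), of q \<alpha> "\<ominus>\<^bsub>P\<^esub> q" "\<ominus> \<alpha>"] assms
    by (simp_all only: transv_cancel transv_closed M.a_inv_closed R.a_inv_closed simp_thms)
  show "\<mu> q \<alpha> \<in> Bij (carrier Q)" "inv\<^bsub>QG\<^esub> (\<mu> q \<alpha>) = \<mu> (\<ominus>\<^bsub>P\<^esub> q) (\<ominus> \<alpha>)"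
    using Bij_by_inverse[OF ext(2) ext(2), of q \<alpha> "\<ominus>\<^bsub>P\<^esub> q" "\<ominus> \<alpha>"] assms
    by (simp_all only: transv_cancel transv_closed M.a_inv_closed R.a_inv_closed simp_thms)
qed

interpretation QG: group QG by (rule group_BijGroup)

abbreviation "Sp \<equiv> ETransSp R P B"
abbreviation "SpI \<equiv> ETransSp_rel R P B I"

lemma Sp_subgroup: "subgroup Sp QG"
  unfolding ETransSp_def
  by (rule QG.generate_is_subgroup) (auto simp: BijGroup_simps transv_Bij)

lemma transv_in_Sp:
  assumes "q \<in> carrier P" "\<alpha> \<in> carrier R" shows "\<rho> q \<alpha> \<in> Sp" "\<mu> q \<alpha> \<in> Sp"
  unfolding ETransSp_def using assms by (auto intro!: generate.incl)

lemma SpI_normal: "SpI \<lhd> (QG\<lparr>carrier := Sp\<rparr>)"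
  unfolding ETransSp_rel_def
proof (rule QG.normal_closure_normal[OF Sp_subgroup])
  show "ETransSp_ideal R P B I \<subseteq> Sp"
    unfolding ETransSp_def ETransSp_ideal_def
    using IP_closed(1) Icarr by (intro QG.mono_generate) blast
qed

lemmas SpI = QG.normal_in_subgroupD[OF Sp_subgroup SpI_normal]

lemma transv_in_SpI:
  assumes "q \<in> IP" "\<alpha> \<in> I" shows "\<rho> q \<alpha> \<in> SpI" "\<mu> q \<alpha> \<in> SpI"
proof -
  have "\<rho> q \<alpha> \<in> ETransSp_ideal R P B I" "\<mu> q \<alpha> \<in> ETransSp_ideal R P B I"
    using assms by (auto simp: ETransSp_ideal_def intro!: generate.incl)
  then show "\<rho> q \<alpha> \<in> SpI" "\<mu> q \<alpha> \<in> SpI"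
    using QG.subset_normal_closure unfolding ETransSp_rel_def by blast+
qed

lemmas Sp_closed = subgroup_Bij_closed[OF Sp_subgroup]
lemmas Sp_apply = subgroup_Bij_apply[OF Sp_subgroup]
lemmas Sp_inv_apply = subgroup_Bij_inv_apply[OF Sp_subgroup]
lemmas Sp_conj_apply = subgroup_Bij_conj_apply[OF Sp_subgroup]
lemmas Sp_mult = subgroup.m_closed[OF Sp_subgroup]
lemmas Sp_inv = subgroup.m_inv_closed[OF Sp_subgroup]

lemma Sp_induct [consumes 1, case_names one rho mu mult]:
  assumes "g \<in> Sp" and "\<Phi> \<one>\<^bsub>QG\<^esub>"
    and "\<And>q \<alpha>. \<lbrakk>q \<in> carrier P; \<alpha> \<in> carrier R\<rbrakk> \<Longrightarrow> \<Phi> (\<rho> q \<alpha>)"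
    and "\<And>q \<alpha>. \<lbrakk>q \<in> carrier P; \<alpha> \<in> carrier R\<rbrakk> \<Longrightarrow> \<Phi> (\<mu> q \<alpha>)"
    and "\<And>g h. \<lbrakk>g \<in> Sp; h \<in> Sp; \<Phi> g; \<Phi> h\<rbrakk> \<Longrightarrow> \<Phi> (g \<otimes>\<^bsub>QG\<^esub> h)"
  shows "\<Phi> g"
proof -
  let ?S = "{\<rho> q \<alpha> | q \<alpha>. q \<in> carrier P \<and> \<alpha> \<in> carrier R} \<union>
    {\<mu> q \<beta> | q \<beta>. q \<in> carrier P \<and> \<beta> \<in> carrier R}"
  have Sp: "Sp = generate QG ?S" by (simp only: ETransSp_def)
  from assms(1) show ?thesis unfolding Sp
  proof (induction rule: QG.generate_induct_inverse_closed)
    case carrier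
    show ?case unfolding BijGroup_simps(1) using transv_Bij(1,3) by blast
  next
    case (inverse s)
    then consider q \<alpha> where "s = \<rho> q \<alpha>" "q \<in> carrier P" "\<alpha> \<in> carrier R"
      | q \<alpha> where "s = \<mu> q \<alpha>" "q \<in> carrier P" "\<alpha> \<in> carrier R" by blast
    then show ?case
      by cases (use transv_Bij(2,4) M.a_inv_closed R.a_inv_closed in \<open>blast\<close>)+
  next
    case one
    show ?case by (rule assms(2))
  next
    case (gen s)
    then show ?case using assms(3,4) by blast
  next
    case (mult x y)
    then show ?case using assms(5)[unfolded Sp] by blast
  qed
qed

subsection \<open>Isometry and congruence\<close>

definition hyp_form where
  "hyp_form = (\<lambda>(a, b, p) (a', b', p'). a \<otimes> b' \<ominus> b \<otimes> a' \<oplus> B p p')"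

lemma hyp_form_triple [simp]: "hyp_form (a, b, p) (a', b', p') = a \<otimes> b' \<ominus> b \<otimes> a' \<oplus> B p p'"
  by (simp add: hyp_form_def)

text \<open>The term \<open>c c' \<langle>q, q\<rangle>\<close> vanishes; the two mixed terms are what cancels in the proof that
transvections are isometries.\<close>

lemma form_shift:
  assumes "p \<in> carrier P" "p' \<in> carrier P" "q \<in> carrier P" "c \<in> carrier R" "c' \<in> carrier R"
  shows "B (p \<ominus>\<^bsub>P\<^esub> c \<odot>\<^bsub>P\<^esub> q) (p' \<ominus>\<^bsub>P\<^esub> c' \<odot>\<^bsub>P\<^esub> q) = B p p' \<ominus> c' \<otimes> B p q \<oplus> c \<otimes> B p' q"
proof -
  have ring: "r \<oplus> \<ominus> (c \<otimes> \<ominus> s') \<oplus> \<ominus> (c' \<otimes> s) = r \<ominus> c' \<otimes> s \<oplus> c \<otimes> s'"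
    if "r \<in> carrier R" "s \<in> carrier R" "s' \<in> carrier R" "c \<in> carrier R" "c' \<in> carrier R"
    for r s s' c c' using that by algebra+
  show ?thesis
    using assms ring[of "B p p'" "B p q" "B p' q" c c']
    by (simp add: form_simps antisymmetric[of p' q])
qed

lemma Sp_isometry:
  assumes "g \<in> Sp" "u \<in> carrier Q" "v \<in> carrier Q" shows "hyp_form (g u) (g v) = hyp_form u v"
  using assms
proof (induction arbitrary: u v rule: Sp_induct)
  case (rho q \<alpha>)
  obtain a b p a' b' p' where uv: "u = (a, b, p)" "v = (a', b', p')" by (cases u, cases v)
  have ring: "a \<otimes> (b' \<ominus> s' \<ominus> \<alpha> \<otimes> a') \<ominus> (b \<ominus> s \<ominus> \<alpha> \<otimes> a) \<otimes> a' \<oplus> (r \<ominus> a' \<otimes> s \<oplus> a \<otimes> s')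
      = a \<otimes> b' \<ominus> b \<otimes> a' \<oplus> r"
    if "r \<in> carrier R" "s \<in> carrier R" "s' \<in> carrier R" "a \<in> carrier R" "a' \<in> carrier R"
      "b \<in> carrier R" "b' \<in> carrier R" "\<alpha> \<in> carrier R"
    for r s s' a a' b b' \<alpha> using that by algebra+
  show ?case
    using rho uv by (simp add: hyp_form_def form_shift ring form_closed)
next
  case (mu q \<alpha>)
  obtain a b p a' b' p' where uv: "u = (a, b, p)" "v = (a', b', p')" by (cases u, cases v)
  have ring: "(a \<oplus> s \<oplus> \<alpha> \<otimes> b) \<otimes> b' \<ominus> b \<otimes> (a' \<oplus> s' \<oplus> \<alpha> \<otimes> b') \<oplus> (r \<ominus> b' \<otimes> s \<oplus> b \<otimes> s')
      = a \<otimes> b' \<ominus> b \<otimes> a' \<oplus> r"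
    if "r \<in> carrier R" "s \<in> carrier R" "s' \<in> carrier R" "a \<in> carrier R" "a' \<in> carrier R"
      "b \<in> carrier R" "b' \<in> carrier R" "\<alpha> \<in> carrier R"
    for r s s' a a' b b' \<alpha> using that by algebra+
  show ?case
    using mu uv by (simp add: hyp_form_def form_shift ring form_closed)
next
  case one
  then show ?case by (simp only: BijGroup_simps(2))
next
  case (mult g h)
  then show ?case by (metis Sp_apply Sp_closed)
qed

definition vcong where
  "vcong = (\<lambda>(a, b, p) (a', b', p'). cong a a' \<and> cong b b' \<and> pcong p p')"

lemma vcong_triple [simp]:
  "vcong (a, b, p) (a', b', p') \<longleftrightarrow> cong a a' \<and> cong b b' \<and> pcong p p'"
  by (simp add: vcong_def)

lemma vcong_trans: "\<lbrakk>vcong u v; vcong v w\<rbrakk> \<Longrightarrow> vcong u w"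
  by (cases u, cases v, cases w) (simp, metis cong_trans pcong_trans)

lemma vcong_refl: "v \<in> carrier Q \<Longrightarrow> vcong v v"
  by (cases v) simp

lemma transv_vcong:
  assumes "vcong u v" "pcong q q'" "cong \<alpha> \<alpha>'"
  shows "vcong (\<rho> q \<alpha> u) (\<rho> q' \<alpha>' v)" "vcong (\<mu> q \<alpha> u) (\<mu> q' \<alpha>' v)"
proof -
  obtain a b p a' b' p' where uv: "u = (a, b, p)" "v = (a', b', p')" by (cases u, cases v)
  then have c: "cong a a'" "cong b b'" "pcong p p'" using assms by simp_all
  note [simp] = cong_closed[OF c(1)] cong_closed[OF c(2)] pcong_closed[OF c(3)]
  show "vcong (\<rho> q \<alpha> u) (\<rho> q' \<alpha>' v)" "vcong (\<mu> q \<alpha> u) (\<mu> q' \<alpha>' v)"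
    using c assms(2,3) unfolding uv by (simp_all add: cong_intros)
qed

lemma Sp_vcong:
  assumes "g \<in> Sp" "vcong u v" "u \<in> carrier Q" "v \<in> carrier Q" shows "vcong (g u) (g v)"
  using assms
proof (induction arbitrary: u v rule: Sp_induct)
  case one
  then show ?case by (simp only: BijGroup_simps(2))
next
  case (mult g h)
  then show ?case by (metis Sp_apply Sp_closed)
qed (simp_all add: transv_vcong)

lemma vcong_sym: "vcong u v \<Longrightarrow> vcong v u"
  by (cases u, cases v) (simp add: cong_sym pcong_sym)

text \<open>The elements of the elementary symplectic group that are the identity modulo \<open>I\<close> form a normal
subgroup, as the group acts on congruence classes; it contains the transvections with parameters in
\<open>I\<close>.\<close>

lemma SpI_vcong:
  assumes "g \<in> SpI" "v \<in> carrier Q" shows "vcong (g v) v"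
proof -
  let ?N = "{g \<in> Sp. \<forall>v \<in> carrier Q. vcong (g v) v}"
  have N: "subgroup ?N QG"
  proof (rule QG.subgroupI)
    show "?N \<subseteq> carrier QG" using subgroup.subset[OF Sp_subgroup] by blast
    have "\<one>\<^bsub>QG\<^esub> \<in> ?N"
      by (intro CollectI conjI ballI subgroup.one_closed[OF Sp_subgroup])
        (simp only: BijGroup_simps(2) vcong_refl)
    then show "?N \<noteq> {}" by blast
    fix g assume g: "g \<in> ?N"
    then have gS: "g \<in> Sp" by blast
    show "inv\<^bsub>QG\<^esub> g \<in> ?N"
    proof (intro CollectI conjI ballI Sp_inv gS)
      fix v assume v: "v \<in> carrier Q"
      let ?w = "(inv\<^bsub>QG\<^esub> g) v"
      have "vcong (g ?w) ?w" using g Sp_closed[OF Sp_inv[OF gS] v] by blast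
      then show "vcong ?w v" unfolding Sp_inv_apply(2)[OF gS v] by (rule vcong_sym)
    qed
    fix h assume h: "h \<in> ?N"
    then have hS: "h \<in> Sp" by blast
    show "g \<otimes>\<^bsub>QG\<^esub> h \<in> ?N"
    proof (intro CollectI conjI ballI Sp_mult gS hS)
      fix v assume v: "v \<in> carrier Q"
      have "vcong (g (h v)) (h v)" "vcong (h v) v" using g h v Sp_closed[OF hS v] by blast+
      then show "vcong ((g \<otimes>\<^bsub>QG\<^esub> h) v) v"
        unfolding Sp_apply[OF gS hS v] by (rule vcong_trans)
    qed
  qed
  have "x \<otimes>\<^bsub>QG\<^esub> g \<otimes>\<^bsub>QG\<^esub> inv\<^bsub>QG\<^esub> x \<in> ?N" if x: "x \<in> Sp" and g: "g \<in> ?N" for x g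
  proof (intro CollectI conjI ballI Sp_mult Sp_inv x)
    show gS: "g \<in> Sp" using g by blast
    fix v assume v: "v \<in> carrier Q"
    let ?w = "(inv\<^bsub>QG\<^esub> x) v"
    have w: "?w \<in> carrier Q" by (rule Sp_closed[OF Sp_inv[OF x] v])
    have "vcong (g ?w) ?w" using g w by blast
    from Sp_vcong[OF x this Sp_closed[OF gS w] w]
    show "vcong ((x \<otimes>\<^bsub>QG\<^esub> g \<otimes>\<^bsub>QG\<^esub> inv\<^bsub>QG\<^esub> x) v) v"
      unfolding Sp_conj_apply[OF x gS v] Sp_inv_apply(2)[OF x v] .
  qed
  then have normal: "?N \<lhd> (QG\<lparr>carrier := Sp\<rparr>)"
    by (intro QG.normal_in_subgroupI[OF Sp_subgroup N]) auto
  have "vcong (\<rho> q \<alpha> v) v \<and> vcong (\<mu> q \<alpha> v) v"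
    if "q \<in> IP" "\<alpha> \<in> I" "v \<in> carrier Q" for q \<alpha> v
  proof -
    have "pcong q \<zero>\<^bsub>P\<^esub>" "cong \<alpha> \<zero>"
      using that IP_closed(1) by (auto simp: pcong_zero_iff cong_zero_iff Icarr)
    then show ?thesis
      using transv_vcong[OF vcong_refl[OF that(3)], of q "\<zero>\<^bsub>P\<^esub>" \<alpha> \<zero>] that(3)
      by (simp add: transv_zero)
  qed
  then have "{\<rho> q \<alpha> | q \<alpha>. q \<in> IP \<and> \<alpha> \<in> I} \<union> {\<mu> q \<alpha> | q \<alpha>. q \<in> IP \<and> \<alpha> \<in> I} \<subseteq> ?N"
    using IP_closed(1) Icarr by (auto simp: subset_iff transv_in_Sp)
  then have "ETransSp_ideal R P B I \<subseteq> ?N"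
    unfolding ETransSp_ideal_def using N by (rule QG.generate_subgroup_incl)
  then have "SpI \<subseteq> ?N" unfolding ETransSp_rel_def using normal by (intro QG.normal_closure_least)
  then show ?thesis using assms by auto
qed

subsection \<open>Moving in parallel\<close>

definition same_orbit where "same_orbit u v \<longleftrightarrow> v \<in> carrier Q \<and> (\<exists>g \<in> SpI. u = g v)"

lemma same_orbit_closed: assumes "same_orbit u v" shows "u \<in> carrier Q" "v \<in> carrier Q"
  using assms SpI(2) Sp_closed unfolding same_orbit_def by blast+

lemma same_orbit_vcong: "same_orbit u v \<Longrightarrow> vcong u v"
  using SpI_vcong unfolding same_orbit_def by blast

lemma same_orbit_refl: "v \<in> carrier Q \<Longrightarrow> same_orbit v v"
  unfolding same_orbit_def
  by (intro conjI bexI[OF _ subgroup.one_closed[OF SpI(1)]]) (simp_all only: BijGroup_simps(2))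

lemma same_orbit_trans:
  assumes "same_orbit u v" "same_orbit v w" shows "same_orbit u w"
proof -
  obtain g h where gh: "g \<in> SpI" "u = g v" "h \<in> SpI" "v = h w" "w \<in> carrier Q"
    using assms unfolding same_orbit_def by blast
  then have "g \<in> Sp" "h \<in> Sp" using SpI(2) by blast+
  then have "u = (g \<otimes>\<^bsub>QG\<^esub> h) w" using gh by (simp only: Sp_apply)
  moreover have "g \<otimes>\<^bsub>QG\<^esub> h \<in> SpI" using gh subgroup.m_closed[OF SpI(1)] by blast
  ultimately show ?thesis using gh(5) unfolding same_orbit_def by blast
qed

lemma same_orbit_sym:
  assumes "same_orbit u v" shows "same_orbit v u"
proof -
  obtain g where g: "g \<in> SpI" "u = g v" and v: "v \<in> carrier Q" using assms unfolding same_orbit_def by blast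
  have "v = (inv\<^bsub>QG\<^esub> g) u" unfolding g(2) using subgroup_Bij_inv_apply(1)[OF SpI(1) g(1) v] ..
  then show ?thesis
    unfolding same_orbit_def using same_orbit_closed(1)[OF assms] subgroup.m_inv_closed[OF SpI(1) g(1)] by blast
qed

lemma same_orbit_Sp:
  assumes x: "x \<in> Sp" and uv: "same_orbit u v" shows "same_orbit (x u) (x v)"
proof -
  obtain g where g: "g \<in> SpI" "u = g v" and v: "v \<in> carrier Q"
    using uv unfolding same_orbit_def by blast
  have gS: "g \<in> Sp" using g(1) SpI(2) by blast
  have xv: "x v \<in> carrier Q" by (rule Sp_closed[OF x v])
  have "(x \<otimes>\<^bsub>QG\<^esub> g \<otimes>\<^bsub>QG\<^esub> inv\<^bsub>QG\<^esub> x) (x v) = x u"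
    unfolding Sp_conj_apply[OF x gS xv] Sp_inv_apply(1)[OF x v] g(2) ..
  then show ?thesis
    using SpI(3)[OF x g(1)] xv unfolding same_orbit_def by metis
qed

text \<open>Transvections with congruent parameters differ by a factor in the relative group: by the composition
law, \<open>\<rho>(q, \<alpha>) = \<rho>(q - q', \<delta>) \<rho>(q', \<alpha>')\<close> with \<open>\<delta> \<in> I\<close>. Normality moves the element that
connects \<open>u\<close> and \<open>v\<close> past the transvection.\<close>

lemma same_orbit_transv:
  assumes uv: "same_orbit u v" and q: "pcong q q'" and \<alpha>: "cong \<alpha> \<alpha>'"
  shows "same_orbit (\<rho> q \<alpha> u) (\<rho> q' \<alpha>' v)" "same_orbit (\<mu> q \<alpha> u) (\<mu> q' \<alpha>' v)"
proof -
  let ?d = "q \<ominus>\<^bsub>P\<^esub> q'" and ?\<delta> = "\<alpha> \<ominus> \<alpha>' \<oplus> B q' (q \<ominus>\<^bsub>P\<^esub> q')"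
  have closed: "q \<in> carrier P" "q' \<in> carrier P" "\<alpha> \<in> carrier R" "\<alpha>' \<in> carrier R" "v \<in> carrier Q"
    using q \<alpha> uv unfolding pcong_def cong_def same_orbit_def by blast+
  have "pcong ?d (q' \<ominus>\<^bsub>P\<^esub> q')" using q closed by (intro cong_intros pcong_refl)
  then have d: "pcong ?d \<zero>\<^bsub>P\<^esub>" using closed by (simp add: M.minus_eq M.r_neg)
  have "cong ?\<delta> (\<alpha>' \<ominus> \<alpha>' \<oplus> B q' \<zero>\<^bsub>P\<^esub>)" using d \<alpha> closed by (intro cong_intros pcong_refl cong_refl)
  then have \<delta>: "cong ?\<delta> \<zero>" using closed by (simp add: R.minus_eq R.r_neg)
  have in_I: "?d \<in> IP" "?\<delta> \<in> I"
    using d \<delta> closed by (simp_all add: pcong_zero_iff cong_zero_iff form_closed)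
  have sum: "?d \<oplus>\<^bsub>P\<^esub> q' = q"
    using closed by (simp add: M.minus_eq M.a_assoc M.l_neg)
  have ring: "\<alpha> \<ominus> \<alpha>' \<oplus> r \<oplus> \<alpha>' \<ominus> r = \<alpha>" if "r \<in> carrier R" "\<alpha> \<in> carrier R" "\<alpha>' \<in> carrier R" for r \<alpha> \<alpha>'
    using that by algebra+
  have "\<rho> q \<alpha> v = \<rho> ?d ?\<delta> (\<rho> q' \<alpha>' v)" "\<mu> q \<alpha> v = \<mu> ?d ?\<delta> (\<mu> q' \<alpha>' v)"
    using closed by (simp_all add: rho_comp mu_comp form_closed sum ring)
  then have "same_orbit (\<rho> q \<alpha> v) (\<rho> q' \<alpha>' v)" "same_orbit (\<mu> q \<alpha> v) (\<mu> q' \<alpha>' v)"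
    unfolding same_orbit_def using transv_in_SpI[OF in_I] closed by (auto simp: transv_closed simp del: in_Q)
  then show "same_orbit (\<rho> q \<alpha> u) (\<rho> q' \<alpha>' v)" "same_orbit (\<mu> q \<alpha> u) (\<mu> q' \<alpha>' v)"
    using same_orbit_trans same_orbit_Sp[OF transv_in_Sp(1)[OF closed(1,3)] uv]
      same_orbit_Sp[OF transv_in_Sp(2)[OF closed(1,3)] uv]
    by blast+
qed

section \<open>Linear transvections\<close>

abbreviation "M \<equiv> sum_module (self_module R) P"

lemma M_module: "module R M"
  by (rule sum_module_module[OF R.self_module_module module_axioms])

lemma sum_module_M: "sum_module (self_module R) M = Q"
  by (simp add: hyp_module_def)

text \<open>By nondegeneracy every linear form on \<open>M = R \<oplus> P\<close> is of this shape. Thus the transvections of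
\<open>Q = R \<oplus> M\<close> of both kinds are parametrized by \<open>R \<times> P\<close>, and those with parameter in \<open>IM\<close> or
\<open>IM\<^sup>*\<close> by \<open>I \<times> IP\<close>.\<close>

definition functional where
  "functional \<beta> q = (\<lambda>(b, p)\<in>carrier M. \<beta> \<otimes> b \<oplus> B p q)"

lemma functional_apply [simp]:
  "\<lbrakk>b \<in> carrier R; p \<in> carrier P\<rbrakk> \<Longrightarrow> functional \<beta> q (b, p) = \<beta> \<otimes> b \<oplus> B p q"
  by (simp add: functional_def)

lemma functional_in_dual:
  assumes "\<beta> \<in> carrier R" "q \<in> carrier P" shows "functional \<beta> q \<in> carrier (dual_module R M)"
proof -
  have ring: "\<beta> \<otimes> (b \<oplus> b') \<oplus> (s \<oplus> s') = \<beta> \<otimes> b \<oplus> s \<oplus> (\<beta> \<otimes> b' \<oplus> s')"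
    "\<beta> \<otimes> (b \<otimes> b') \<oplus> b \<otimes> s = b \<otimes> (\<beta> \<otimes> b' \<oplus> s)"
    if "\<beta> \<in> carrier R" "b \<in> carrier R" "b' \<in> carrier R" "s \<in> carrier R" "s' \<in> carrier R"
    for \<beta> b b' s s' using that by algebra+
  show ?thesis
    using assms by (auto simp: in_dual_module_iff functional_def form_simps ring)
qed

lemma dual_functional:
  assumes \<tau>: "\<tau> \<in> carrier (dual_module R M)"
  obtains \<beta> q where "\<beta> \<in> carrier R" "q \<in> carrier P" "\<tau> = functional \<beta> q"
proof -
  note \<tau>' = \<tau>[unfolded in_dual_module_iff]
  have add: "\<tau> ((b, p) \<oplus>\<^bsub>M\<^esub> (b', p')) = \<tau> (b, p) \<oplus> \<tau> (b', p')"
    if "b \<in> carrier R" "b' \<in> carrier R" "p \<in> carrier P" "p' \<in> carrier P" for b b' p p'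
    using \<tau>' that by (simp del: sum_module_simps(3) add: sum_module_simps(1))
  have smult: "\<tau> (a \<odot>\<^bsub>M\<^esub> (b, p)) = a \<otimes> \<tau> (b, p)"
    if "a \<in> carrier R" "b \<in> carrier R" "p \<in> carrier P" for a b p
    using \<tau>' that by (simp del: sum_module_simps(4) add: sum_module_simps(1))
  have closed: "\<tau> (b, p) \<in> carrier R" if "b \<in> carrier R" "p \<in> carrier P" for b p
    using \<tau>' that by simp
  \<comment> \<open>The sign of \<open>x\<close> changes below because \<open>nondegenerate\<close>
    puts the variable in the second argument of the form and \<open>functional\<close> in the first.\<close>
  have "(\<lambda>p\<in>carrier P. \<tau> (\<zero>, p)) \<in> carrier (dual_module R P)"
    using add[of \<zero> \<zero>] smult[of _ \<zero>] closed by (auto simp: in_dual_module_iff)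
  then obtain x where x: "x \<in> carrier P"
    and eq: "(\<lambda>p\<in>carrier P. \<tau> (\<zero>, p)) = (\<lambda>p\<in>carrier P. B x p)"
    using nondegenerate unfolding bij_betw_def by blast
  have on_pairs: "\<tau> (b, p) = functional (\<tau> (\<one>, \<zero>\<^bsub>P\<^esub>)) (\<ominus>\<^bsub>P\<^esub> x) (b, p)"
    if bp: "b \<in> carrier R" "p \<in> carrier P" for b p
  proof -
    have "\<tau> (b, p) = \<tau> (b, \<zero>\<^bsub>P\<^esub>) \<oplus> \<tau> (\<zero>, p)" using add[of b \<zero> "\<zero>\<^bsub>P\<^esub>" p] bp by simp
    moreover have "\<tau> (b, \<zero>\<^bsub>P\<^esub>) = b \<otimes> \<tau> (\<one>, \<zero>\<^bsub>P\<^esub>)" using smult[of b \<one> "\<zero>\<^bsub>P\<^esub>"] bp by simp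
    moreover have "\<tau> (\<zero>, p) = B p (\<ominus>\<^bsub>P\<^esub> x)"
      using fun_cong[OF eq, of p] bp x by (simp add: form_minus antisymmetric[of p x] form_closed)
    ultimately show ?thesis using bp closed[of \<one> "\<zero>\<^bsub>P\<^esub>"] by (simp add: R.m_comm)
  qed
  have eq: "\<tau> u = functional (\<tau> (\<one>, \<zero>\<^bsub>P\<^esub>)) (\<ominus>\<^bsub>P\<^esub> x) u" if uM: "u \<in> carrier M" for u
  proof -
    obtain b p where u: "u = (b, p)" "b \<in> carrier R" "p \<in> carrier P" using uM by auto
    show ?thesis unfolding u(1) by (rule on_pairs[OF u(2,3)])
  qed
  have "\<tau> = functional (\<tau> (\<one>, \<zero>\<^bsub>P\<^esub>)) (\<ominus>\<^bsub>P\<^esub> x)"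
    by (rule extensionalityI[OF _ _ eq]) (use \<tau>' in \<open>simp_all only: functional_def restrict_extensional\<close>)
  then show ?thesis by (intro that[of "\<tau> (\<one>, \<zero>\<^bsub>P\<^esub>)" "\<ominus>\<^bsub>P\<^esub> x"] closed M.a_inv_closed x) simp_all
qed

lemma functional_add:
  assumes "\<beta> \<in> carrier R" "q \<in> carrier P" "\<beta>' \<in> carrier R" "q' \<in> carrier P"
  shows "functional \<beta> q \<oplus>\<^bsub>dual_module R M\<^esub> functional \<beta>' q' = functional (\<beta> \<oplus> \<beta>') (q \<oplus>\<^bsub>P\<^esub> q')"
proof -
  have ring: "\<beta> \<otimes> b \<oplus> s \<oplus> (\<beta>' \<otimes> b \<oplus> s') = (\<beta> \<oplus> \<beta>') \<otimes> b \<oplus> (s \<oplus> s')"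
    if "\<beta> \<in> carrier R" "\<beta>' \<in> carrier R" "b \<in> carrier R" "s \<in> carrier R" "s' \<in> carrier R"
    for \<beta> \<beta>' b s s' using that by algebra+
  show ?thesis
    using assms by (auto simp: functional_def form_simps ring intro!: restrict_ext)
qed

lemma functional_smult:
  assumes "\<beta> \<in> carrier R" "q \<in> carrier P" "a \<in> carrier R"
  shows "a \<odot>\<^bsub>dual_module R M\<^esub> functional \<beta> q = functional (a \<otimes> \<beta>) (a \<odot>\<^bsub>P\<^esub> q)"
  using assms by (auto simp: functional_def form_simps R.r_distr R.m_assoc intro!: restrict_ext)

lemma ideal_smult_M: "ideal_smult R I M = I \<times> IP"
proof
  interpret MM: module R M by (rule M_module)
  have zero: "\<zero> \<in> I" by (rule additive_subgroup.zero_closed[OF is_additive_subgroup])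
  show "ideal_smult R I M \<subseteq> I \<times> IP"
  proof (rule ideal_smult_least)
    show "submodule (I \<times> IP) R M"
    proof (rule MM.submoduleI)
      fix u assume u: "u \<in> I \<times> IP"
      then obtain c q where u': "u = (c, q)" "c \<in> I" "q \<in> IP" by blast
      then have "\<ominus>\<^bsub>M\<^esub> u = (\<ominus> c, \<ominus>\<^bsub>P\<^esub> q)"
        using IP_closed(1) by (intro MM.minus_equality) (auto simp: Icarr R.l_neg M.l_neg)
      then show "\<ominus>\<^bsub>M\<^esub> u \<in> I \<times> IP" using u' IP_closed(3) by simp
    qed (use IP_closed(1,4,5) submodule_zero[OF IP] zero in \<open>auto simp: Icarr I_l_closed\<close>)
    show "a \<odot>\<^bsub>M\<^esub> x \<in> I \<times> IP" if "a \<in> I" "x \<in> carrier M" for a x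
      using that ideal_smult_incl[OF is_ideal] by (auto simp: I_r_closed)
  qed
  note sub = MM.ideal_smult_submodule[OF is_ideal]
  have "IP \<subseteq> {q \<in> carrier P. (\<zero>, q) \<in> ideal_smult R I M}"
  proof (rule ideal_smult_least)
    show "submodule {q \<in> carrier P. (\<zero>, q) \<in> ideal_smult R I M} R P"
    proof (rule submoduleI)
      fix q assume q: "q \<in> {q \<in> carrier P. (\<zero>, q) \<in> ideal_smult R I M}"
      then have "\<ominus>\<^bsub>M\<^esub> (\<zero>, q) = (\<zero>, \<ominus>\<^bsub>P\<^esub> q)" by (intro MM.minus_equality) (auto simp: M.l_neg)
      then show "\<ominus>\<^bsub>P\<^esub> q \<in> {q \<in> carrier P. (\<zero>, q) \<in> ideal_smult R I M}"
        using q MM.submoduleE(3)[OF sub, of "(\<zero>, q)"] by simp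
      fix q' assume q': "q' \<in> {q \<in> carrier P. (\<zero>, q) \<in> ideal_smult R I M}"
      show "q \<oplus>\<^bsub>P\<^esub> q' \<in> {q \<in> carrier P. (\<zero>, q) \<in> ideal_smult R I M}"
        using q q' MM.submoduleE(5)[OF sub, of "(\<zero>, q)" "(\<zero>, q')"] by simp
    next
      fix a q assume a: "a \<in> carrier R" and q: "q \<in> {q \<in> carrier P. (\<zero>, q) \<in> ideal_smult R I M}"
      then show "a \<odot>\<^bsub>P\<^esub> q \<in> {q \<in> carrier P. (\<zero>, q) \<in> ideal_smult R I M}"
        using MM.submoduleE(4)[OF sub a, of "(\<zero>, q)"] by simp
    qed (use MM.submodule_zero[OF sub] in auto)
    show "a \<odot>\<^bsub>P\<^esub> x \<in> {q \<in> carrier P. (\<zero>, q) \<in> ideal_smult R I M}" if "a \<in> I" "x \<in> carrier P" for a x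
      using MM.ideal_smult_incl[OF is_ideal that(1), of "(\<zero>, x)"] that by (simp add: Icarr)
  qed
  moreover have "(c, \<zero>\<^bsub>P\<^esub>) \<in> ideal_smult R I M" if "c \<in> I" for c
    using MM.ideal_smult_incl[OF is_ideal that, of "(\<one>, \<zero>\<^bsub>P\<^esub>)"] that by (simp add: Icarr)
  ultimately show "I \<times> IP \<subseteq> ideal_smult R I M"
    using MM.submoduleE(5)[OF sub] by (force simp: Icarr)
qed

lemma ideal_smult_dual:
  "ideal_smult R I (dual_module R M) = {functional \<beta> q | \<beta> q. \<beta> \<in> I \<and> q \<in> IP}"
proof
  let ?D = "dual_module R M" and ?N = "{functional \<beta> q | \<beta> q. \<beta> \<in> I \<and> q \<in> IP}"
  interpret MM: module R M by (rule M_module)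
  interpret D: module R ?D by (rule MM.dual_module_module)
  have zero: "\<zero> \<in> I" by (rule additive_subgroup.zero_closed[OF is_additive_subgroup])
  have IPc: "q \<in> carrier P" if "q \<in> IP" for q using that IP_closed(1) by blast
  have func_zero: "functional \<zero> \<zero>\<^bsub>P\<^esub> = \<zero>\<^bsub>?D\<^esub>"
    by (auto simp: functional_def intro!: restrict_ext)
  show "ideal_smult R I ?D \<subseteq> ?N"
  proof (rule ideal_smult_least)
    show "submodule ?N R ?D"
    proof (rule D.submoduleI)
      show "?N \<subseteq> carrier ?D" using functional_in_dual by (auto simp: Icarr IPc)
      show "\<zero>\<^bsub>?D\<^esub> \<in> ?N" using zero submodule_zero[OF IP] func_zero[symmetric] by blast
    next
      fix \<tau> assume "\<tau> \<in> ?N"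
      then obtain \<beta> q where \<tau>: "\<tau> = functional \<beta> q" "\<beta> \<in> I" "q \<in> IP" by blast
      have "\<ominus>\<^bsub>?D\<^esub> \<tau> = functional (\<ominus> \<beta>) (\<ominus>\<^bsub>P\<^esub> q)"
        using \<tau> func_zero
        by (intro D.minus_equality)
          (simp_all del: dual_module_simps add: functional_add functional_in_dual Icarr IPc R.l_neg M.l_neg)
      moreover have "\<ominus> \<beta> \<in> I" "\<ominus>\<^bsub>P\<^esub> q \<in> IP" using \<tau> IP_closed(3) by auto
      ultimately show "\<ominus>\<^bsub>?D\<^esub> \<tau> \<in> ?N" by blast
    next
      fix \<tau> \<tau>' assume "\<tau> \<in> ?N" "\<tau>' \<in> ?N"
      then obtain \<beta> q \<beta>' q' where \<tau>: "\<tau> = functional \<beta> q" "\<beta> \<in> I" "q \<in> IP"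
        "\<tau>' = functional \<beta>' q'" "\<beta>' \<in> I" "q' \<in> IP" by blast
      moreover have "\<beta> \<oplus> \<beta>' \<in> I" "q \<oplus>\<^bsub>P\<^esub> q' \<in> IP" using \<tau> IP_closed(5) by auto
      ultimately show "\<tau> \<oplus>\<^bsub>?D\<^esub> \<tau>' \<in> ?N" using functional_add[of \<beta> q \<beta>' q'] Icarr IPc by blast
    next
      fix a \<tau> assume a: "a \<in> carrier R" and "\<tau> \<in> ?N"
      then obtain \<beta> q where \<tau>: "\<tau> = functional \<beta> q" "\<beta> \<in> I" "q \<in> IP" by blast
      moreover have "a \<otimes> \<beta> \<in> I" "a \<odot>\<^bsub>P\<^esub> q \<in> IP" using \<tau> a IP_closed(4) I_l_closed by auto
      ultimately show "a \<odot>\<^bsub>?D\<^esub> \<tau> \<in> ?N" using functional_smult[of \<beta> q a] Icarr IPc a by blast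
    qed
  next
    fix a \<tau> assume a: "a \<in> I" and "\<tau> \<in> carrier ?D"
    then obtain \<beta> q where \<tau>: "\<beta> \<in> carrier R" "q \<in> carrier P" "\<tau> = functional \<beta> q"
      using dual_functional by blast
    moreover have "a \<otimes> \<beta> \<in> I" "a \<odot>\<^bsub>P\<^esub> q \<in> IP"
      using \<tau> a ideal_smult_incl[OF is_ideal] I_r_closed by auto
    ultimately show "a \<odot>\<^bsub>?D\<^esub> \<tau> \<in> ?N" using functional_smult[of \<beta> q a] Icarr a by blast
  qed
  note sub = D.ideal_smult_submodule[OF is_ideal]
  let ?S = "{q \<in> carrier P. functional \<zero> q \<in> ideal_smult R I ?D}"
  have "IP \<subseteq> ?S"
  proof (rule ideal_smult_least)
    show "submodule ?S R P"
    proof (rule submoduleI)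
      fix q assume q: "q \<in> ?S"
      then have "\<ominus>\<^bsub>?D\<^esub> functional \<zero> q = functional \<zero> (\<ominus>\<^bsub>P\<^esub> q)"
        using func_zero
        by (intro D.minus_equality)
          (simp_all del: dual_module_simps add: functional_add functional_in_dual M.l_neg)
      then show "\<ominus>\<^bsub>P\<^esub> q \<in> ?S" using q D.submoduleE(3)[OF sub, of "functional \<zero> q"] by simp
      fix q' assume q': "q' \<in> ?S"
      show "q \<oplus>\<^bsub>P\<^esub> q' \<in> ?S"
        using q q' D.submoduleE(5)[OF sub, of "functional \<zero> q" "functional \<zero> q'"]
        by (simp del: dual_module_simps add: functional_add)
    next
      fix a q assume a: "a \<in> carrier R" and q: "q \<in> ?S"
      then show "a \<odot>\<^bsub>P\<^esub> q \<in> ?S"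
        using D.submoduleE(4)[OF sub a, of "functional \<zero> q"]
        by (simp del: dual_module_simps add: functional_smult)
    next
      show "\<zero>\<^bsub>P\<^esub> \<in> ?S" using D.submodule_zero[OF sub] func_zero by simp
    qed auto
    fix a x assume a: "a \<in> I" and x: "x \<in> carrier P"
    then show "a \<odot>\<^bsub>P\<^esub> x \<in> ?S"
      using D.ideal_smult_incl[OF is_ideal a functional_in_dual[of \<zero> x]]
      by (simp del: dual_module_simps add: functional_smult Icarr)
  qed
  have unit_part: "functional \<beta> \<zero>\<^bsub>P\<^esub> \<in> ideal_smult R I ?D" if "\<beta> \<in> I" for \<beta>
    using D.ideal_smult_incl[OF is_ideal that functional_in_dual[of \<one> "\<zero>\<^bsub>P\<^esub>"]] that
    by (simp del: dual_module_simps add: functional_smult Icarr)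
  have split: "functional \<beta> q = functional \<beta> \<zero>\<^bsub>P\<^esub> \<oplus>\<^bsub>?D\<^esub> functional \<zero> q" if "\<beta> \<in> I" "q \<in> IP" for \<beta> q
    using that by (simp del: dual_module_simps add: functional_add Icarr IPc)
  show "?N \<subseteq> ideal_smult R I ?D"
  proof
    fix \<tau> assume "\<tau> \<in> ?N"
    then obtain \<beta> q where \<tau>: "\<tau> = functional \<beta> q" "\<beta> \<in> I" "q \<in> IP" by blast
    show "\<tau> \<in> ideal_smult R I ?D"
      unfolding \<tau>(1) split[OF \<tau>(2,3)]
      using \<open>IP \<subseteq> ?S\<close> \<tau> by (intro D.submoduleE(5)[OF sub] unit_part) auto
  qed
qed

abbreviation "Lin \<equiv> ETrans R M"
abbreviation "LinI \<equiv> ETrans_rel R M I"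
abbreviation "\<epsilon> c q \<equiv> lin_transv R M (c, q)"
abbreviation "\<delta> \<beta> q \<equiv> lin_transv_dual R M (functional \<beta> q)"

lemma lin_apply [simp]:
  assumes "a \<in> carrier R" "b \<in> carrier R" "p \<in> carrier P"
  shows "\<epsilon> c q (a, b, p) = (a, b \<oplus> a \<otimes> c, p \<oplus>\<^bsub>P\<^esub> a \<odot>\<^bsub>P\<^esub> q)"
    and "\<delta> \<beta> q (a, b, p) = (a \<oplus> (\<beta> \<otimes> b \<oplus> B p q), b, p)"
  using assms by (simp_all add: lin_transv_def lin_transv_dual_def)

lemma lin_closed:
  assumes "v \<in> carrier Q" "c \<in> carrier R" "q \<in> carrier P"
  shows "\<epsilon> c q v \<in> carrier Q" "\<delta> c q v \<in> carrier Q"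
  using assms by (cases v; simp add: form_closed)+

lemma lin_zero:
  assumes "v \<in> carrier Q" shows "\<epsilon> \<zero> \<zero>\<^bsub>P\<^esub> v = v" "\<delta> \<zero> \<zero>\<^bsub>P\<^esub> v = v"
  using assms by (cases v; simp)+

lemma lin_cancel:
  assumes "v \<in> carrier Q" "c \<in> carrier R" "q \<in> carrier P"
  shows "\<epsilon> (\<ominus> c) (\<ominus>\<^bsub>P\<^esub> q) (\<epsilon> c q v) = v" "\<epsilon> c q (\<epsilon> (\<ominus> c) (\<ominus>\<^bsub>P\<^esub> q) v) = v"
    "\<delta> (\<ominus> c) (\<ominus>\<^bsub>P\<^esub> q) (\<delta> c q v) = v" "\<delta> c q (\<delta> (\<ominus> c) (\<ominus>\<^bsub>P\<^esub> q) v) = v"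
proof -
  obtain a b p where v: "v = (a, b, p)" by (cases v)
  have ring: "b \<oplus> a \<otimes> c \<oplus> \<ominus> (a \<otimes> c) = b" "b \<oplus> \<ominus> (a \<otimes> c) \<oplus> a \<otimes> c = b"
      "a \<oplus> (c \<otimes> b \<oplus> s) \<oplus> (\<ominus> (c \<otimes> b) \<oplus> \<ominus> s) = a" "a \<oplus> (\<ominus> (c \<otimes> b) \<oplus> \<ominus> s) \<oplus> (c \<otimes> b \<oplus> s) = a"
    if "a \<in> carrier R" "b \<in> carrier R" "c \<in> carrier R" "s \<in> carrier R" for a b c s
    using that by algebra+
  show "\<epsilon> (\<ominus> c) (\<ominus>\<^bsub>P\<^esub> q) (\<epsilon> c q v) = v" "\<epsilon> c q (\<epsilon> (\<ominus> c) (\<ominus>\<^bsub>P\<^esub> q) v) = v"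
    "\<delta> (\<ominus> c) (\<ominus>\<^bsub>P\<^esub> q) (\<delta> c q v) = v" "\<delta> c q (\<delta> (\<ominus> c) (\<ominus>\<^bsub>P\<^esub> q) v) = v"
    using assms unfolding v
    by (simp_all add: form_simps ring R.r_minus R.l_minus smult_r_minus M.a_assoc M.l_neg M.r_neg)
qed

lemma lin_Bij:
  assumes "c \<in> carrier R" "q \<in> carrier P"
  shows "\<epsilon> c q \<in> Bij (carrier Q)" "inv\<^bsub>QG\<^esub> (\<epsilon> c q) = \<epsilon> (\<ominus> c) (\<ominus>\<^bsub>P\<^esub> q)"
    and "\<delta> c q \<in> Bij (carrier Q)" "inv\<^bsub>QG\<^esub> (\<delta> c q) = \<delta> (\<ominus> c) (\<ominus>\<^bsub>P\<^esub> q)"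
proof -
  have ext: "\<epsilon> c q \<in> extensional (carrier Q)" "\<delta> c q \<in> extensional (carrier Q)" for c q
    by (simp_all only: lin_transv_def lin_transv_dual_def sum_module_M restrict_extensional)
  show "\<epsilon> c q \<in> Bij (carrier Q)" "inv\<^bsub>QG\<^esub> (\<epsilon> c q) = \<epsilon> (\<ominus> c) (\<ominus>\<^bsub>P\<^esub> q)"
    using Bij_by_inverse[OF ext(1) ext(1), of c q "\<ominus> c" "\<ominus>\<^bsub>P\<^esub> q"] assms
    by (simp_all only: lin_cancel lin_closed M.a_inv_closed R.a_inv_closed simp_thms)
  show "\<delta> c q \<in> Bij (carrier Q)" "inv\<^bsub>QG\<^esub> (\<delta> c q) = \<delta> (\<ominus> c) (\<ominus>\<^bsub>P\<^esub> q)"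
    using Bij_by_inverse[OF ext(2) ext(2), of c q "\<ominus> c" "\<ominus>\<^bsub>P\<^esub> q"] assms
    by (simp_all only: lin_cancel lin_closed M.a_inv_closed R.a_inv_closed simp_thms)
qed

definition lin_gens where
  "lin_gens J U = {\<epsilon> c q | c q. c \<in> J \<and> q \<in> U} \<union> {\<delta> \<beta> q | \<beta> q. \<beta> \<in> J \<and> q \<in> U}"

lemma lin_gens_image:
  "lin_gens J U = lin_transv R M ` (J \<times> U) \<union> lin_transv_dual R M ` {functional \<beta> q | \<beta> q. \<beta> \<in> J \<and> q \<in> U}"
  unfolding lin_gens_def by blast

lemma Lin_generated: "Lin = generate QG (lin_gens (carrier R) (carrier P))"
proof -
  have "carrier (dual_module R M) = {functional \<beta> q | \<beta> q. \<beta> \<in> carrier R \<and> q \<in> carrier P}"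
    using functional_in_dual dual_functional by blast
  moreover have "carrier M = carrier R \<times> carrier P" by simp
  ultimately show ?thesis unfolding ETrans_def sum_module_M lin_gens_image by simp
qed

lemma ETrans_ideal_generated: "ETrans_ideal R M I = generate QG (lin_gens I IP)"
  unfolding ETrans_ideal_def sum_module_M lin_gens_image ideal_smult_M ideal_smult_dual ..

lemma lin_gens_mono: "lin_gens I IP \<subseteq> lin_gens (carrier R) (carrier P)"
  unfolding lin_gens_def using IP_closed(1) Icarr by blast

lemma lin_gens_carrier: "lin_gens (carrier R) (carrier P) \<subseteq> carrier QG"
  unfolding lin_gens_def BijGroup_simps(1) using lin_Bij(1,3) by blast

lemma lin_gens_inv:
  assumes "s \<in> lin_gens (carrier R) (carrier P)" shows "inv\<^bsub>QG\<^esub> s \<in> lin_gens (carrier R) (carrier P)"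
proof -
  from assms consider c q where "s = \<epsilon> c q" "c \<in> carrier R" "q \<in> carrier P"
    | c q where "s = \<delta> c q" "c \<in> carrier R" "q \<in> carrier P"
    unfolding lin_gens_def by blast
  then show ?thesis
    unfolding lin_gens_def
    by cases (use lin_Bij(2,4) M.a_inv_closed R.a_inv_closed in \<open>blast\<close>)+
qed

lemma Lin_subgroup: "subgroup Lin QG"
  unfolding Lin_generated by (rule QG.generate_is_subgroup[OF lin_gens_carrier])

lemma LinI_normal: "LinI \<lhd> (QG\<lparr>carrier := Lin\<rparr>)"
  unfolding ETrans_rel_def sum_module_M
proof (rule QG.normal_closure_normal[OF Lin_subgroup])
  show "ETrans_ideal R M I \<subseteq> Lin"
    unfolding Lin_generated ETrans_ideal_generated by (rule QG.mono_generate[OF lin_gens_mono])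
qed

lemmas LinI = QG.normal_in_subgroupD[OF Lin_subgroup LinI_normal]
lemmas Lin_closed = subgroup_Bij_closed[OF Lin_subgroup]
lemmas Lin_apply = subgroup_Bij_apply[OF Lin_subgroup]
lemmas Lin_inv_apply = subgroup_Bij_inv_apply[OF Lin_subgroup]
lemmas Lin_conj_apply = subgroup_Bij_conj_apply[OF Lin_subgroup]
lemmas Lin_mult = subgroup.m_closed[OF Lin_subgroup]
lemmas Lin_inv = subgroup.m_inv_closed[OF Lin_subgroup]

lemma lin_in_Lin:
  assumes "c \<in> carrier R" "q \<in> carrier P" shows "\<epsilon> c q \<in> Lin" "\<delta> c q \<in> Lin"
  unfolding Lin_generated by (rule generate.incl, use assms in \<open>auto simp: lin_gens_def\<close>)+

lemma lin_in_LinI: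
  assumes "c \<in> I" "q \<in> IP" shows "\<epsilon> c q \<in> LinI" "\<delta> c q \<in> LinI"
proof -
  have "ETrans_ideal R M I \<subseteq> LinI"
    unfolding ETrans_rel_def sum_module_M by (rule QG.subset_normal_closure)
  moreover have "\<epsilon> c q \<in> ETrans_ideal R M I" "\<delta> c q \<in> ETrans_ideal R M I"
    unfolding ETrans_ideal_generated by (rule generate.incl, use assms in \<open>auto simp: lin_gens_def\<close>)+
  ultimately show "\<epsilon> c q \<in> LinI" "\<delta> c q \<in> LinI" by blast+
qed

subsection \<open>Symplectic transvections are products of linear ones\<close>

text \<open>The commutator of \<open>\<epsilon>(-1, 0)\<close> with \<open>a \<mapsto> a - \<langle>p, q\<rangle>\<close> is the shear
\<open>b \<mapsto> b + \<langle>p, q\<rangle>\<close>, and the commutator of \<open>\<delta>(-1, 0)\<close> with \<open>p \<mapsto> p - a q\<close> is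
\<open>p \<mapsto> p - b q\<close>. These supply the parts of \<open>\<rho>\<close> and \<open>\<mu>\<close> that are not linear transvections.
As commutators, they lie in any normal subgroup containing one of the two factors, so that a single
argument serves for the absolute and the relative group.\<close>

lemma transv_in_normal:
  assumes N: "subgroup N QG" "N \<subseteq> Lin"
    and conj: "\<And>x k. \<lbrakk>x \<in> Lin; k \<in> N\<rbrakk> \<Longrightarrow> x \<otimes>\<^bsub>QG\<^esub> k \<otimes>\<^bsub>QG\<^esub> inv\<^bsub>QG\<^esub> x \<in> N"
    and q: "q \<in> carrier P" and \<alpha>: "\<alpha> \<in> carrier R"
    and gens: "\<epsilon> \<alpha> q \<in> N" "\<delta> \<alpha> q \<in> N" "\<epsilon> \<zero> q \<in> N" "\<delta> \<zero> q \<in> N"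
  shows "\<rho> q \<alpha> \<in> N" "\<mu> q \<alpha> \<in> N"
proof -
  have commutator: "x \<otimes>\<^bsub>QG\<^esub> k \<otimes>\<^bsub>QG\<^esub> inv\<^bsub>QG\<^esub> x \<otimes>\<^bsub>QG\<^esub> inv\<^bsub>QG\<^esub> k \<in> N" if "x \<in> Lin" "k \<in> N" for x k
    using that conj subgroup.m_closed[OF N(1)] subgroup.m_inv_closed[OF N(1)] by blast
  have commutator_apply: "(x \<otimes>\<^bsub>QG\<^esub> k \<otimes>\<^bsub>QG\<^esub> inv\<^bsub>QG\<^esub> x \<otimes>\<^bsub>QG\<^esub> inv\<^bsub>QG\<^esub> k) v
      = x (k ((inv\<^bsub>QG\<^esub> x) ((inv\<^bsub>QG\<^esub> k) v)))"
    if "x \<in> Lin" "k \<in> N" "v \<in> carrier Q" for x k v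
  proof -
    have k: "k \<in> Lin" using that N(2) by blast
    show ?thesis by (simp only: Lin_apply Lin_mult Lin_inv Lin_closed that(1,3) k)
  qed
  \<comment> \<open>\<open>?s\<close> is the shear and \<open>?t\<close> the map \<open>p \<mapsto> p - b q\<close>.\<close>
  let ?x = "\<epsilon> (\<ominus> \<one>) \<zero>\<^bsub>P\<^esub>" and ?k = "inv\<^bsub>QG\<^esub> (\<delta> \<zero> q)"
  let ?y = "\<delta> (\<ominus> \<one>) \<zero>\<^bsub>P\<^esub>" and ?l = "inv\<^bsub>QG\<^esub> (\<epsilon> \<zero> q)"
  let ?s = "?x \<otimes>\<^bsub>QG\<^esub> ?k \<otimes>\<^bsub>QG\<^esub> inv\<^bsub>QG\<^esub> ?x \<otimes>\<^bsub>QG\<^esub> inv\<^bsub>QG\<^esub> ?k"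
  let ?t = "?y \<otimes>\<^bsub>QG\<^esub> ?l \<otimes>\<^bsub>QG\<^esub> inv\<^bsub>QG\<^esub> ?y \<otimes>\<^bsub>QG\<^esub> inv\<^bsub>QG\<^esub> ?l"
  have xy: "?x \<in> Lin" "?y \<in> Lin" by (simp_all add: lin_in_Lin)
  have kl: "?k \<in> N" "?l \<in> N" using gens subgroup.m_inv_closed[OF N(1)] by blast+
  have st: "?s \<in> N" "?t \<in> N" using commutator xy kl by blast+
  have inv_inv: "inv\<^bsub>QG\<^esub> ?k = \<delta> \<zero> q" "inv\<^bsub>QG\<^esub> ?l = \<epsilon> \<zero> q"
    using gens subgroup.mem_carrier[OF N(1)] by simp_all
  have inv_xy: "inv\<^bsub>QG\<^esub> ?x = \<epsilon> \<one> \<zero>\<^bsub>P\<^esub>" "inv\<^bsub>QG\<^esub> ?y = \<delta> \<one> \<zero>\<^bsub>P\<^esub>"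
    "?k = \<delta> (\<ominus> \<zero>) (\<ominus>\<^bsub>P\<^esub> q)" "?l = \<epsilon> (\<ominus> \<zero>) (\<ominus>\<^bsub>P\<^esub> q)"
    using lin_Bij(2,4)[of "\<ominus> \<one>" "\<zero>\<^bsub>P\<^esub>"] lin_Bij(2,4)[of \<zero> q] q by simp_all
  have s: "?s (a, b, p) = (a, b \<oplus> B p q, p)"
    if "a \<in> carrier R" "b \<in> carrier R" "p \<in> carrier P" for a b p
  proof -
    have ring: "b \<oplus> (a \<oplus> s) \<oplus> \<ominus> (a \<oplus> s \<oplus> \<ominus> s) = b \<oplus> s" "a \<oplus> s \<oplus> \<ominus> s = a"
      if "a \<in> carrier R" "b \<in> carrier R" "s \<in> carrier R" for a b s
      using that by algebra+
    show ?thesis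
      unfolding commutator_apply[OF xy(1) kl(1) in_Q[THEN iffD2, OF conjI[OF that(1) conjI[OF that(2,3)]]]]
      unfolding inv_inv unfolding inv_xy
      using that q ring[of a b "B p q"]
      by (simp add: form_simps R.r_minus)
  qed
  have t: "?t (a, b, p) = (a, b, p \<ominus>\<^bsub>P\<^esub> b \<odot>\<^bsub>P\<^esub> q)"
    if "a \<in> carrier R" "b \<in> carrier R" "p \<in> carrier P" for a b p
  proof -
    have ring: "a \<oplus> b \<oplus> \<ominus> b = a" 
      if "a \<in> carrier R" "b \<in> carrier R" for a b
      using that by algebra+
    have "p \<oplus>\<^bsub>P\<^esub> a \<odot>\<^bsub>P\<^esub> q \<oplus>\<^bsub>P\<^esub> (a \<oplus> b) \<odot>\<^bsub>P\<^esub> (\<ominus>\<^bsub>P\<^esub> q) = p \<ominus>\<^bsub>P\<^esub> b \<odot>\<^bsub>P\<^esub> q"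
      using that q
      by (simp add: smult_l_distr smult_r_minus M.minus_eq M.minus_add M.a_assoc M.r_neg1 M.r_neg2)
    then show ?thesis
      unfolding commutator_apply[OF xy(2) kl(2) in_Q[THEN iffD2, OF conjI[OF that(1) conjI[OF that(2,3)]]]]
      unfolding inv_inv unfolding inv_xy
      using that q ring[of a b]
      by (simp add: form_simps R.l_minus)
  qed
  have comp_in: "f \<in> N" if f: "f \<in> Bij (carrier Q)" and gh: "g \<in> N" "h \<in> N"
    and eq: "\<And>a b p. \<lbrakk>a \<in> carrier R; b \<in> carrier R; p \<in> carrier P\<rbrakk> \<Longrightarrow> f (a, b, p) = g (h (a, b, p))"
    for f g h
  proof -
    have gh': "g \<otimes>\<^bsub>QG\<^esub> h \<in> N" by (rule subgroup.m_closed[OF N(1) gh])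
    have "f = g \<otimes>\<^bsub>QG\<^esub> h"
    proof (rule Bij_eqI[OF f subgroup_Bij[OF N(1) gh']])
      fix v assume v: "v \<in> carrier Q"
      show "f v = (g \<otimes>\<^bsub>QG\<^esub> h) v"
        unfolding subgroup_Bij_apply[OF N(1) gh v] by (cases v) (use eq v in simp)
    qed
    then show ?thesis using gh' by simp
  qed
  have inv_s: "inv\<^bsub>QG\<^esub> ?s \<in> N" "inv\<^bsub>QG\<^esub> (\<epsilon> \<alpha> q) \<in> N"
    using st gens subgroup.m_inv_closed[OF N(1)] by blast+
  have s': "(inv\<^bsub>QG\<^esub> ?s) (a, b, p) = (a, b \<ominus> B p q, p)"
    if "a \<in> carrier R" "b \<in> carrier R" "p \<in> carrier P" for a b p
  proof -
    have "?s (a, b \<ominus> B p q, p) = (a, b, p)"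
      using s[of a "b \<ominus> B p q" p] that q by (simp add: R.minus_eq R.a_assoc R.l_neg form_closed)
    then show ?thesis
      using subgroup_Bij_inv_apply(1)[OF N(1) st(1), of "(a, b \<ominus> B p q, p)"] that q
      by (simp add: form_closed)
  qed
  show "\<rho> q \<alpha> \<in> N"
  proof (rule comp_in[OF transv_Bij(1)[OF q \<alpha>] inv_s])
    have ring: "b \<ominus> s \<ominus> \<alpha> \<otimes> a = b \<oplus> \<ominus> (a \<otimes> \<alpha>) \<ominus> s"
      if "a \<in> carrier R" "b \<in> carrier R" "s \<in> carrier R" "\<alpha> \<in> carrier R" for a b s \<alpha>
      using that by algebra+
    fix a b p assume "a \<in> carrier R" "b \<in> carrier R" "p \<in> carrier P"
    then show "\<rho> q \<alpha> (a, b, p) = (inv\<^bsub>QG\<^esub> ?s) ((inv\<^bsub>QG\<^esub> (\<epsilon> \<alpha> q)) (a, b, p))"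
      unfolding lin_Bij(2)[OF \<alpha> q]
      using q \<alpha> by (simp add: s' form_simps ring R.r_minus smult_r_minus)
  qed
  show "\<mu> q \<alpha> \<in> N"
  proof (rule comp_in[OF transv_Bij(3)[OF q \<alpha>] st(2) gens(2)])
    have ring: "a \<oplus> s \<oplus> \<alpha> \<otimes> b = a \<oplus> (\<alpha> \<otimes> b \<oplus> s)"
      if "a \<in> carrier R" "b \<in> carrier R" "s \<in> carrier R" "\<alpha> \<in> carrier R" for a b s \<alpha>
      using that by algebra+
    fix a b p assume "a \<in> carrier R" "b \<in> carrier R" "p \<in> carrier P"
    then show "\<mu> q \<alpha> (a, b, p) = ?t (\<delta> \<alpha> q (a, b, p))"
      using q \<alpha> by (simp add: t form_simps ring)
  qed
qed

lemma Sp_subset_Lin: "Sp \<subseteq> Lin"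
proof -
  have "x \<otimes>\<^bsub>QG\<^esub> k \<otimes>\<^bsub>QG\<^esub> inv\<^bsub>QG\<^esub> x \<in> Lin" if "x \<in> Lin" "k \<in> Lin" for x k
    using that Lin_mult Lin_inv by blast
  then have "\<rho> q \<alpha> \<in> Lin" "\<mu> q \<alpha> \<in> Lin" if "q \<in> carrier P" "\<alpha> \<in> carrier R" for q \<alpha>
    using that transv_in_normal[OF Lin_subgroup order_refl, of q \<alpha>] by (simp_all add: lin_in_Lin)
  then show ?thesis
    unfolding ETransSp_def by (intro QG.generate_subgroup_incl Lin_subgroup) blast
qed

text \<open>The relative linear group is normalized by the linear group, which contains the symplectic one; so
its intersection with the symplectic group is one of the normal subgroups over which the symplectic
normal closure is taken.\<close>

lemma SpI_subset_LinI: "SpI \<subseteq> LinI"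
proof -
  have zero: "\<zero> \<in> I" by (rule additive_subgroup.zero_closed[OF is_additive_subgroup])
  have "\<rho> q \<alpha> \<in> LinI" "\<mu> q \<alpha> \<in> LinI" if "q \<in> IP" "\<alpha> \<in> I" for q \<alpha>
    using that zero IP_closed(1) transv_in_normal[OF LinI(1,2,3), of q \<alpha>]
    by (auto simp: lin_in_LinI Icarr)
  then have gens: "ETransSp_ideal R P B I \<subseteq> LinI"
    unfolding ETransSp_ideal_def by (intro QG.generate_subgroup_incl LinI(1)) blast
  have "LinI \<inter> Sp \<lhd> (QG\<lparr>carrier := Sp\<rparr>)"
  proof (rule QG.normal_in_subgroupI[OF Sp_subgroup])
    show "subgroup (LinI \<inter> Sp) QG" by (rule QG.subgroups_Inter_pair[OF LinI(1) Sp_subgroup])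
    show "x \<otimes>\<^bsub>QG\<^esub> k \<otimes>\<^bsub>QG\<^esub> inv\<^bsub>QG\<^esub> x \<in> LinI \<inter> Sp" if x: "x \<in> Sp" and k: "k \<in> LinI \<inter> Sp" for x k
    proof (rule IntI)
      show "x \<otimes>\<^bsub>QG\<^esub> k \<otimes>\<^bsub>QG\<^esub> inv\<^bsub>QG\<^esub> x \<in> LinI"
        by (rule LinI(3)) (use x k Sp_subset_Lin in blast)+
      show "x \<otimes>\<^bsub>QG\<^esub> k \<otimes>\<^bsub>QG\<^esub> inv\<^bsub>QG\<^esub> x \<in> Sp" using x k by (intro Sp_mult Sp_inv) blast+
    qed
  qed blast
  moreover have "ETransSp_ideal R P B I \<subseteq> Sp"
    using SpI(2) QG.subset_normal_closure unfolding ETransSp_rel_def by blast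
  ultimately have "SpI \<subseteq> LinI \<inter> Sp"
    using gens QG.normal_closure_least[of "LinI \<inter> Sp" Sp "ETransSp_ideal R P B I"]
    unfolding ETransSp_rel_def by blast
  then show ?thesis by blast
qed

end

section \<open>Shears of unimodular vectors\<close>

locale relative_symplectic_half = relative_symplectic R P B I
  for R :: "('a, 'r) ring_scheme" (structure) and P :: "('a, 'b, 'k) module_scheme" (structure)
    and B and I +
  fixes h
  assumes half_closed: "h \<in> carrier R" and half: "h \<oplus> h = \<one>"
begin

lemma transv_on_line:
  assumes "a \<in> carrier R" "b \<in> carrier R" "p \<in> carrier P" "q \<in> carrier P"
    "x \<in> carrier R" "y \<in> carrier R" "\<alpha> \<in> carrier R"
  shows "\<rho> (y \<odot>\<^bsub>P\<^esub> q) \<alpha> (a, b, p \<oplus>\<^bsub>P\<^esub> x \<odot>\<^bsub>P\<^esub> q) =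
      (a, b \<ominus> y \<otimes> B p q \<ominus> \<alpha> \<otimes> a, p \<oplus>\<^bsub>P\<^esub> (x \<ominus> a \<otimes> y) \<odot>\<^bsub>P\<^esub> q)"
    and "\<mu> (y \<odot>\<^bsub>P\<^esub> q) \<alpha> (a, b, p \<oplus>\<^bsub>P\<^esub> x \<odot>\<^bsub>P\<^esub> q) =
      (a \<oplus> y \<otimes> B p q \<oplus> \<alpha> \<otimes> b, b, p \<oplus>\<^bsub>P\<^esub> (x \<ominus> b \<otimes> y) \<odot>\<^bsub>P\<^esub> q)"
  using assms
  by (simp_all add: form_simps R.minus_eq smult_l_distr smult_l_minus smult_assoc1 M.a_assoc)

text \<open>The triples over the ring of pairs that describe two vectors \<open>(a, b, p + x q)\<close> and
\<open>(a', b', p' + x' q')\<close> in the same orbit. The two base points \<open>p\<close> and \<open>p'\<close> and the two directions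
are congruent but may differ.\<close>

definition line_states where
  "line_states p q p' q' = {((a, a'), (b, b'), (x, x')). cong a a' \<and> cong b b' \<and> cong x x' \<and>
     same_orbit (a, b, p \<oplus>\<^bsub>P\<^esub> x \<odot>\<^bsub>P\<^esub> q) (a', b', p' \<oplus>\<^bsub>P\<^esub> x' \<odot>\<^bsub>P\<^esub> q')}"

lemma scalar_states_line:
  assumes p: "pcong p p'" and q: "pcong q q'"
  shows "scalar_states K (B p q, B p' q') (h, h) (line_states p q p' q')"
proof (intro scalar_states.intro scalar_states_axioms.intro cring_congruent_pairs)
  note closed = pcong_closed[OF p] pcong_closed[OF q]
  have t: "cong (B p q) (B p' q')" using p q by (rule form_cong)
  show "(B p q, B p' q') \<in> carrier K" using t by simp
  show "(h, h) \<in> carrier K" "(h, h) \<oplus>\<^bsub>K\<^esub> (h, h) = \<one>\<^bsub>K\<^esub>" by (simp_all add: half half_closed)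
  show "line_states p q p' q' \<subseteq> carrier K \<times> carrier K \<times> carrier K"
    by (auto simp: line_states_def)
  fix A C X Y D
  assume s: "(A, C, X) \<in> line_states p q p' q'" and YD: "Y \<in> carrier K" "D \<in> carrier K"
  obtain a a' b b' x x' y y' d d'
    where [simp]: "A = (a, a')" "C = (b, b')" "X = (x, x')" "Y = (y, y')" "D = (d, d')"
    by (cases A, cases C, cases X, cases Y, cases D)
  have c: "cong a a'" "cong b b'" "cong x x'" "cong y y'" "cong d d'"
    and sm: "same_orbit (a, b, p \<oplus>\<^bsub>P\<^esub> x \<odot>\<^bsub>P\<^esub> q) (a', b', p' \<oplus>\<^bsub>P\<^esub> x' \<odot>\<^bsub>P\<^esub> q')"
    using s YD by (auto simp: line_states_def)
  note cl = cong_closed[OF c(1)] cong_closed[OF c(2)] cong_closed[OF c(3)] cong_closed[OF c(4)]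
    cong_closed[OF c(5)] closed
  note simps = congruent_pairs_simps congruent_pairs_minus c t cong_intros
  from same_orbit_transv[OF sm pcong_smult[OF c(4) q] c(5)]
  have "same_orbit (a, b \<ominus> y \<otimes> B p q \<ominus> d \<otimes> a, p \<oplus>\<^bsub>P\<^esub> (x \<ominus> a \<otimes> y) \<odot>\<^bsub>P\<^esub> q)
      (a', b' \<ominus> y' \<otimes> B p' q' \<ominus> d' \<otimes> a', p' \<oplus>\<^bsub>P\<^esub> (x' \<ominus> a' \<otimes> y') \<odot>\<^bsub>P\<^esub> q')"
    and "same_orbit (a \<oplus> y \<otimes> B p q \<oplus> d \<otimes> b, b, p \<oplus>\<^bsub>P\<^esub> (x \<ominus> b \<otimes> y) \<odot>\<^bsub>P\<^esub> q)
      (a' \<oplus> y' \<otimes> B p' q' \<oplus> d' \<otimes> b', b', p' \<oplus>\<^bsub>P\<^esub> (x' \<ominus> b' \<otimes> y') \<odot>\<^bsub>P\<^esub> q')"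
    by (simp_all only: transv_on_line cl)
  then show "(A, C \<ominus>\<^bsub>K\<^esub> Y \<otimes>\<^bsub>K\<^esub> (B p q, B p' q') \<ominus>\<^bsub>K\<^esub> D \<otimes>\<^bsub>K\<^esub> A, X \<ominus>\<^bsub>K\<^esub> A \<otimes>\<^bsub>K\<^esub> Y) \<in> line_states p q p' q'"
    and "(A \<oplus>\<^bsub>K\<^esub> Y \<otimes>\<^bsub>K\<^esub> (B p q, B p' q') \<oplus>\<^bsub>K\<^esub> D \<otimes>\<^bsub>K\<^esub> C, C, X \<ominus>\<^bsub>K\<^esub> C \<otimes>\<^bsub>K\<^esub> Y) \<in> line_states p q p' q'"
    by (simp_all add: line_states_def simps)
qed

lemma line_states_zero:
  assumes "pcong p p'" "pcong q q'"
  shows "((a, a'), (b, b'), (\<zero>, \<zero>)) \<in> line_states p q p' q' \<longleftrightarrow> same_orbit (a, b, p) (a', b', p')"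
  using assms same_orbit_vcong[of "(a, b, p)" "(a', b', p')"]
  by (auto simp: line_states_def pcong_closed)

lemma same_orbit_triple:
  assumes "same_orbit (a, b, p) (a', b', p')" shows "cong a a'" "cong b b'" "pcong p p'"
  using same_orbit_vcong[OF assms] by simp_all

lemma same_orbit_add_multiple:
  assumes s: "same_orbit (a, b, p) (a', b', p')" and c: "cong c c'"
  shows "same_orbit (a, b \<oplus> c \<otimes> a, p) (a', b' \<oplus> c' \<otimes> a', p')"
proof -
  note p = same_orbit_triple(3)[OF s]
  interpret S: scalar_states K "(B p p, B p' p')" "(h, h)" "line_states p p p' p'"
    by (rule scalar_states_line[OF p p])
  from S.add_multiple_to_snd[of "(a, a')" "(b, b')" "(\<zero>, \<zero>)" "(c, c')"] show ?thesis
    using s c by (simp add: line_states_zero p)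
qed

lemma same_orbit_scale:
  assumes s: "same_orbit (a, b, p) (a', b', p')" and c: "cong c c'" and q: "pcong q q'"
  shows "same_orbit (a, b \<oplus> c \<otimes> b \<otimes> B p q, p) (a', b' \<oplus> c' \<otimes> b' \<otimes> B p' q', p')"
proof -
  note p = same_orbit_triple(3)[OF s]
  interpret S: scalar_states K "(B p q, B p' q')" "(h, h)" "line_states p q p' q'"
    by (rule scalar_states_line[OF p q])
  from S.scale_snd[of "(a, a')" "(b, b')" "(\<zero>, \<zero>)" "(c, c')"] show ?thesis
    using s c by (simp add: line_states_zero p q)
qed

lemma same_orbit_add_square:
  assumes s: "same_orbit (a, b, p) (a', b', p')" and c: "cong c c'" and q: "pcong q q'"
  shows "same_orbit (a, b \<oplus> c \<otimes> (B p q \<otimes> B p q), p) (a', b' \<oplus> c' \<otimes> (B p' q' \<otimes> B p' q'), p')"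
proof -
  note p = same_orbit_triple(3)[OF s]
  interpret S: scalar_states K "(B p q, B p' q')" "(h, h)" "line_states p q p' q'"
    by (rule scalar_states_line[OF p q])
  from S.add_square_to_snd[of "(a, a')" "(b, b')" "(\<zero>, \<zero>)" "(c, c')"] show ?thesis
    using s c by (simp add: line_states_zero p q)
qed

text \<open>Polarization: \<open>2 t s = (t + s)\<^sup>2 - t\<^sup>2 - s\<^sup>2\<close>, and \<open>p\<close> is unchanged by the moves that add squares,
so they can be made along \<open>q + z\<close>, \<open>q\<close> and \<open>z\<close> in turn.\<close>

lemma same_orbit_add_product:
  assumes s: "same_orbit (a, b, p) (a', b', p')" and q: "pcong q q'" and z: "pcong z z'"
  shows "same_orbit (a, b \<oplus> B p q \<otimes> B p z, p) (a', b' \<oplus> B p' q' \<otimes> B p' z', p')"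
proof -
  have ring: "b \<oplus> h \<otimes> ((t \<oplus> s) \<otimes> (t \<oplus> s)) \<oplus> \<ominus> h \<otimes> (t \<otimes> t) \<oplus> \<ominus> h \<otimes> (s \<otimes> s) = b \<oplus> t \<otimes> s"
    if "b \<in> carrier R" "t \<in> carrier R" "s \<in> carrier R" for b t s
  proof -
    have "b \<oplus> h \<otimes> ((t \<oplus> s) \<otimes> (t \<oplus> s)) \<oplus> \<ominus> h \<otimes> (t \<otimes> t) \<oplus> \<ominus> h \<otimes> (s \<otimes> s) = b \<oplus> (h \<oplus> h) \<otimes> (t \<otimes> s)"
      using that half_closed by algebra
    then show ?thesis using that by (simp add: half)
  qed
  note c = same_orbit_triple[OF s] and h = cong_refl[OF half_closed]
  note cl = cong_closed[OF c(1)] cong_closed[OF c(2)] pcong_closed[OF c(3)] pcong_closed[OF q] pcong_closed[OF z]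
  from same_orbit_add_square[OF same_orbit_add_square[OF same_orbit_add_square[OF s h pcong_add[OF q z]]
      cong_minus[OF h] q] cong_minus[OF h] z]
  show ?thesis by (simp only: form_add_right cl ring form_closed)
qed

text \<open>With \<open>t = \<langle>p, q\<rangle>\<close>, multiplying \<open>1 = \<alpha> a + \<beta> b + \<langle>p, z\<rangle>\<close> by \<open>t\<close> writes \<open>t\<close> as a sum of three
terms that can be added to \<open>b\<close>. The term \<open>\<beta> t b\<close> comes first, because the scaling uses the
current value of \<open>b\<close>; the other two do not depend on \<open>b\<close>.\<close>

lemma same_orbit_shear:
  assumes s: "same_orbit (a, b, p) (a', b', p')" and q: "pcong q q'"
    and w: "cong \<alpha> \<alpha>'" "cong \<beta> \<beta>'" "pcong z z'"
    and unimod: "\<alpha> \<otimes> a \<oplus> \<beta> \<otimes> b \<oplus> B p z = \<one>" "\<alpha>' \<otimes> a' \<oplus> \<beta>' \<otimes> b' \<oplus> B p' z' = \<one>"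
  shows "same_orbit (a, b \<oplus> B p q, p) (a', b' \<oplus> B p' q', p')"
proof -
  have ring: "b \<oplus> \<beta> \<otimes> b \<otimes> t \<oplus> \<alpha> \<otimes> t \<otimes> a \<oplus> t \<otimes> s = b \<oplus> t"
    if "a \<in> carrier R" "b \<in> carrier R" "\<alpha> \<in> carrier R" "\<beta> \<in> carrier R" "t \<in> carrier R" "s \<in> carrier R"
      and one: "\<alpha> \<otimes> a \<oplus> \<beta> \<otimes> b \<oplus> s = \<one>" for a b \<alpha> \<beta> t s
  proof -
    have "b \<oplus> \<beta> \<otimes> b \<otimes> t \<oplus> \<alpha> \<otimes> t \<otimes> a \<oplus> t \<otimes> s = b \<oplus> (\<alpha> \<otimes> a \<oplus> \<beta> \<otimes> b \<oplus> s) \<otimes> t"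
      using that(1-6) by algebra
    then show ?thesis using that(5) by (simp add: one)
  qed
  note c = same_orbit_triple[OF s]
  note cl = cong_closed[OF c(1)] cong_closed[OF c(2)] pcong_closed[OF c(3)] pcong_closed[OF q]
    cong_closed[OF w(1)] cong_closed[OF w(2)] pcong_closed[OF w(3)]
  have t: "cong (B p q) (B p' q')" using c(3) q by (rule form_cong)
  from same_orbit_add_product[OF same_orbit_add_multiple[OF same_orbit_scale[OF s w(2) q]
        cong_mult[OF w(1) t]] q w(3)]
  show ?thesis by (simp only: ring cl form_closed unimod)
qed

interpretation QG: group QG by (rule group_BijGroup)

text \<open>The hyperbolic form on \<open>Q\<close> is nondegenerate like that of \<open>P\<close>, so a linear form with value \<open>1\<close> at
\<open>v\<close> is given by a vector \<open>w\<close>. The advantage of \<open>w\<close> over the linear form is that isometries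
carry it along with \<open>v\<close>.\<close>

definition unimod where
  "unimod v \<longleftrightarrow> v \<in> carrier Q \<and> (\<exists>w \<in> carrier Q. hyp_form v w = \<one>)"

definition shear where
  "shear q = (\<lambda>(a, b, p). (a, b \<oplus> B p q, p))"

lemma shear_triple [simp]: "shear q (a, b, p) = (a, b \<oplus> B p q, p)"
  by (simp add: shear_def)

lemma Sp_unimod:
  assumes g: "g \<in> Sp" and v: "unimod v" shows "unimod (g v)"
proof -
  obtain w where w: "v \<in> carrier Q" "w \<in> carrier Q" "hyp_form v w = \<one>" using v unfolding unimod_def by blast
  have "hyp_form (g v) (g w) = \<one>" using Sp_isometry[OF g w(1,2)] w(3) by simp
  then show ?thesis unfolding unimod_def using Sp_closed[OF g] w by blast
qed

lemma shear_unimod: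
  assumes v: "unimod v" and q: "q \<in> carrier P" shows "unimod (shear q v)"
proof -
  obtain a b p a' b' p' where v': "v = (a, b, p)" "v \<in> carrier Q" "(a', b', p') \<in> carrier Q"
    and one: "hyp_form v (a', b', p') = \<one>"
    using v unfolding unimod_def by (cases v) auto
  have ring: "a \<otimes> b' \<ominus> (b \<oplus> t) \<otimes> a' \<oplus> (s \<oplus> a' \<otimes> t) = a \<otimes> b' \<ominus> b \<otimes> a' \<oplus> s"
    if "a \<in> carrier R" "a' \<in> carrier R" "b \<in> carrier R" "b' \<in> carrier R" "s \<in> carrier R" "t \<in> carrier R"
    for a a' b b' s t using that by algebra+
  have "hyp_form (shear q v) (a', b', p' \<oplus>\<^bsub>P\<^esub> a' \<odot>\<^bsub>P\<^esub> q) = \<one>"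
    using v' q one by (simp add: form_closed form_add_right form_smult_right ring)
  moreover have "(a', b', p' \<oplus>\<^bsub>P\<^esub> a' \<odot>\<^bsub>P\<^esub> q) \<in> carrier Q" "shear q v \<in> carrier Q"
    using v' q by (simp_all add: form_closed)
  ultimately show ?thesis unfolding unimod_def by blast
qed

text \<open>If \<open>u = g v\<close>, then \<open>g w\<close> is dual to \<open>u\<close> and congruent to \<open>w\<close>, which provides the congruent
coefficients that \<open>same_orbit_shear\<close> asks for.\<close>

lemma same_orbit_shear_unimod:
  assumes s: "same_orbit u v" and v: "unimod v" and q: "pcong q q'" shows "same_orbit (shear q u) (shear q' v)"
proof -
  obtain g where g: "g \<in> SpI" "u = g v" using s unfolding same_orbit_def by blast
  have gS: "g \<in> Sp" using g SpI(2) by blast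
  obtain w where w: "v \<in> carrier Q" "w \<in> carrier Q" "hyp_form v w = \<one>" using v unfolding unimod_def by blast
  obtain a b p a' b' p' where uv: "u = (a, b, p)" "v = (a', b', p')" by (cases u, cases v)
  obtain x y z x' y' z' where gw: "g w = (x, y, z)" "w = (x', y', z')" by (cases "g w", cases w)
  have c: "cong x x'" "cong y y'" "pcong z z'"
    using SpI_vcong[OF g(1) w(2)] unfolding gw(1) unfolding gw(2) by simp_all
  have "hyp_form u (x, y, z) = \<one>"
    using Sp_isometry[OF gS w(1,2)] w(3) unfolding g(2) gw(1) by simp
  moreover have "u \<in> carrier Q" by (rule same_orbit_closed(1)[OF s])
  moreover have ring: "y \<otimes> a \<oplus> \<ominus> x \<otimes> b \<oplus> s = a \<otimes> y \<ominus> b \<otimes> x \<oplus> s"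
    if "a \<in> carrier R" "b \<in> carrier R" "x \<in> carrier R" "y \<in> carrier R" "s \<in> carrier R"
    for a b x y s using that by algebra+
  ultimately have "y \<otimes> a \<oplus> \<ominus> x \<otimes> b \<oplus> B p z = \<one>" "y' \<otimes> a' \<oplus> \<ominus> x' \<otimes> b' \<oplus> B p' z' = \<one>"
    using w cong_closed[OF c(1)] cong_closed[OF c(2)] pcong_closed[OF c(3)] unfolding uv gw(2)
    by (simp_all add: form_closed)
  from same_orbit_shear[OF s[unfolded uv] q c(2) cong_minus[OF c(1)] c(3) this]
  show ?thesis unfolding uv by simp
qed

subsection \<open>Linear transvections in parallel\<close>

text \<open>For \<open>\<zeta> = \<plusminus>1\<close>, the product of elementary matrices that represents the Weyl element
\<open>(a, b) \<mapsto> \<plusminus>(b, -a)\<close>. It exchanges the two coordinates, and with them shears of \<open>b\<close> and of \<open>a\<close>.\<close>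

definition quarter_turn where
  "quarter_turn \<zeta> v = \<mu> \<zero>\<^bsub>P\<^esub> \<zeta> (\<rho> \<zero>\<^bsub>P\<^esub> \<zeta> (\<mu> \<zero>\<^bsub>P\<^esub> \<zeta> v))"

lemma quarter_turn_apply:
  assumes "a \<in> carrier R" "b \<in> carrier R" "p \<in> carrier P"
  shows "quarter_turn \<one> (a, b, p) = (b, \<ominus> a, p)" "quarter_turn (\<ominus> \<one>) (a, b, p) = (\<ominus> b, a, p)"
proof -
  have ring: "b \<ominus> (a \<oplus> b) = \<ominus> a" "a \<oplus> b \<oplus> \<ominus> a = b" "b \<oplus> (a \<oplus> \<ominus> b) = a" "a \<oplus> \<ominus> b \<oplus> \<ominus> a = \<ominus> b"
    if "a \<in> carrier R" "b \<in> carrier R" for a b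
    using that by algebra+
  show "quarter_turn \<one> (a, b, p) = (b, \<ominus> a, p)" "quarter_turn (\<ominus> \<one>) (a, b, p) = (\<ominus> b, a, p)"
    using assms ring[of a b]
    by (simp_all add: quarter_turn_def M.minus_eq R.l_minus) (simp_all add: R.minus_eq ring)
qed

text \<open>The transvection \<open>\<rho>(-q, -c)\<close> agrees with \<open>\<epsilon>(c, q)\<close> except that it also adds \<open>\<langle>p, q\<rangle>\<close> to \<open>b\<close>.
For \<open>\<delta>(c, q)\<close> the shear has to act on \<open>a\<close>, so it is conjugated by a quarter turn.\<close>

lemma lin_via_shear:
  assumes "v \<in> carrier Q" "c \<in> carrier R" "q \<in> carrier P"
  shows "\<epsilon> c q v = shear (\<ominus>\<^bsub>P\<^esub> q) (\<rho> (\<ominus>\<^bsub>P\<^esub> q) (\<ominus> c) v)"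
    and "\<delta> c q v =
      \<mu> \<zero>\<^bsub>P\<^esub> c (quarter_turn (\<ominus> \<one>) (shear (\<ominus>\<^bsub>P\<^esub> q) (quarter_turn \<one> v)))"
proof -
  obtain a b p where v: "v = (a, b, p)" by (cases v)
  have ring: "b \<ominus> \<ominus> s \<ominus> \<ominus> (c \<otimes> a) \<oplus> \<ominus> s = b \<oplus> a \<otimes> c" "\<ominus> (\<ominus> a \<oplus> \<ominus> s) \<oplus> c \<otimes> b = a \<oplus> (c \<otimes> b \<oplus> s)"
    if "a \<in> carrier R" "b \<in> carrier R" "c \<in> carrier R" "s \<in> carrier R" for a b c s
    using that by algebra+
  show "\<epsilon> c q v = shear (\<ominus>\<^bsub>P\<^esub> q) (\<rho> (\<ominus>\<^bsub>P\<^esub> q) (\<ominus> c) v)"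
    using assms ring unfolding v by (simp add: form_simps R.l_minus smult_r_minus)
  show "\<delta> c q v = \<mu> \<zero>\<^bsub>P\<^esub> c (quarter_turn (\<ominus> \<one>) (shear (\<ominus>\<^bsub>P\<^esub> q) (quarter_turn \<one> v)))"
    using assms ring unfolding v by (simp add: form_simps quarter_turn_apply)
qed

lemma same_orbit_quarter_turn:
  assumes "\<zeta> \<in> carrier R" shows "same_orbit u v \<Longrightarrow> same_orbit (quarter_turn \<zeta> u) (quarter_turn \<zeta> v)"
    and "unimod v \<Longrightarrow> unimod (quarter_turn \<zeta> v)"
  unfolding quarter_turn_def using assms
  by (simp_all add: same_orbit_transv Sp_unimod transv_in_Sp)

lemma lin_unimod:
  assumes v: "unimod v" and cq: "c \<in> carrier R" "q \<in> carrier P"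
  shows "unimod (\<epsilon> c q v)" "unimod (\<delta> c q v)"
proof -
  have vQ: "v \<in> carrier Q" using v unfolding unimod_def by blast
  note q' = M.a_inv_closed[OF cq(2)]
  show "unimod (\<epsilon> c q v)"
    unfolding lin_via_shear(1)[OF vQ cq]
    by (rule shear_unimod[OF Sp_unimod[OF transv_in_Sp(1)[OF q' R.a_inv_closed[OF cq(1)]] v] q'])
  show "unimod (\<delta> c q v)"
    unfolding lin_via_shear(2)[OF vQ cq]
    by (rule Sp_unimod[OF transv_in_Sp(2)[OF M.zero_closed cq(1)]
          same_orbit_quarter_turn(2)[OF R.a_inv_closed[OF R.one_closed]
            shear_unimod[OF same_orbit_quarter_turn(2)[OF R.one_closed v] q']]])
qed

lemma same_orbit_lin:
  assumes s: "same_orbit u v" and v: "unimod v" and c: "cong c c'" and q: "pcong q q'"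
  shows "same_orbit (\<epsilon> c q u) (\<epsilon> c' q' v)" "same_orbit (\<delta> c q u) (\<delta> c' q' v)"
proof -
  note cl = cong_closed[OF c] pcong_closed[OF q]
  note uv = same_orbit_closed[OF s]
  note mq = pcong_minus[OF q]
  show "same_orbit (\<epsilon> c q u) (\<epsilon> c' q' v)"
    unfolding lin_via_shear(1)[OF uv(1) cl(1,3)] lin_via_shear(1)[OF uv(2) cl(2,4)]
    by (rule same_orbit_shear_unimod[OF same_orbit_transv(1)[OF s mq cong_minus[OF c]]
          Sp_unimod[OF transv_in_Sp(1)[OF pcong_closed(2)[OF mq] cong_closed(2)[OF cong_minus[OF c]]] v]
          mq])
  show "same_orbit (\<delta> c q u) (\<delta> c' q' v)"
    unfolding lin_via_shear(2)[OF uv(1) cl(1,3)] lin_via_shear(2)[OF uv(2) cl(2,4)]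
    by (rule same_orbit_transv(2)[OF same_orbit_quarter_turn(1)[OF R.a_inv_closed[OF R.one_closed]
            same_orbit_shear_unimod[OF same_orbit_quarter_turn(1)[OF R.one_closed s]
              same_orbit_quarter_turn(2)[OF R.one_closed v] mq]]
          pcong_refl[OF M.zero_closed] c])
qed

lemma Lin_unimod_same_orbit:
  assumes "g \<in> Lin"
  shows "\<forall>v. unimod v \<longrightarrow> unimod (g v) \<and> (\<forall>u. same_orbit u v \<longrightarrow> same_orbit (g u) (g v))"
  using assms unfolding Lin_generated
proof (induction rule: QG.generate_induct_inverse_closed)
  case carrier
  show ?case by (rule lin_gens_carrier)
next
  case (inverse s)
  then show ?case by (rule lin_gens_inv)
next
  case one
  show ?case
  proof (intro allI impI conjI)
    fix v assume v: "unimod v"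
    have vQ: "v \<in> carrier Q" using v unfolding unimod_def by blast
    show "unimod (\<one>\<^bsub>QG\<^esub> v)" unfolding BijGroup_simps(2)[OF vQ] by (rule v)
    fix u assume s: "same_orbit u v"
    show "same_orbit (\<one>\<^bsub>QG\<^esub> u) (\<one>\<^bsub>QG\<^esub> v)"
      unfolding BijGroup_simps(2)[OF vQ] BijGroup_simps(2)[OF same_orbit_closed(1)[OF s]] by (rule s)
  qed
next
  case (gen s)
  then consider c q where "s = \<epsilon> c q" "c \<in> carrier R" "q \<in> carrier P"
    | c q where "s = \<delta> c q" "c \<in> carrier R" "q \<in> carrier P"
    unfolding lin_gens_def by blast
  then show ?case by cases (simp_all add: lin_unimod same_orbit_lin)
next
  case (mult g h)
  have gh: "g \<in> Lin" "h \<in> Lin" using mult(1,2) unfolding Lin_generated by blast+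
  show ?case
  proof (intro allI impI conjI)
    fix v assume v: "unimod v"
    have vQ: "v \<in> carrier Q" using v unfolding unimod_def by blast
    show "unimod ((g \<otimes>\<^bsub>QG\<^esub> h) v)" unfolding Lin_apply[OF gh vQ] using mult v by blast
    fix u assume s: "same_orbit u v"
    show "same_orbit ((g \<otimes>\<^bsub>QG\<^esub> h) u) ((g \<otimes>\<^bsub>QG\<^esub> h) v)"
      unfolding Lin_apply[OF gh vQ] Lin_apply[OF gh same_orbit_closed(1)[OF s]] using mult v s by blast
  qed
qed

text \<open>Since the linear group permutes the orbits of unimodular vectors, its elements that fix all these
orbits form a normal subgroup. It contains the transvections with parameters in \<open>I\<close>, as they are
congruent to \<open>\<epsilon>(0, 0)\<close> and \<open>\<delta>(0, 0)\<close>.\<close>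

lemma LinI_same_orbit:
  assumes "g \<in> LinI" "unimod v" shows "same_orbit (g v) v"
proof -
  let ?N = "{g \<in> Lin. \<forall>v. unimod v \<longrightarrow> same_orbit (g v) v}"
  have unimod_closed: "v \<in> carrier Q" if "unimod v" for v using that unfolding unimod_def by blast
  have Lin_unimod: "unimod (g v)" if "g \<in> Lin" "unimod v" for g v
    using Lin_unimod_same_orbit[OF that(1)] that(2) by blast
  have Lin_same_orbit: "same_orbit (g u) (g v)" if "g \<in> Lin" "unimod v" "same_orbit u v" for g u v
    using Lin_unimod_same_orbit[OF that(1)] that(2,3) by blast
  have N: "subgroup ?N QG"
  proof (rule QG.subgroupI)
    show "?N \<subseteq> carrier QG" using subgroup.subset[OF Lin_subgroup] by blast
    have "\<one>\<^bsub>QG\<^esub> \<in> ?N"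
      by (intro CollectI conjI allI impI subgroup.one_closed[OF Lin_subgroup])
        (simp only: BijGroup_simps(2) unimod_closed same_orbit_refl)
    then show "?N \<noteq> {}" by blast
    fix g assume g: "g \<in> ?N"
    then have gL: "g \<in> Lin" by blast
    show "inv\<^bsub>QG\<^esub> g \<in> ?N"
    proof (intro CollectI conjI allI impI Lin_inv gL)
      fix v assume v: "unimod v"
      let ?w = "(inv\<^bsub>QG\<^esub> g) v"
      have "same_orbit (g ?w) ?w" using g Lin_unimod[OF Lin_inv[OF gL] v] by blast
      then show "same_orbit ?w v" unfolding Lin_inv_apply(2)[OF gL unimod_closed[OF v]] by (rule same_orbit_sym)
    qed
    fix h assume h: "h \<in> ?N"
    then have hL: "h \<in> Lin" by blast
    show "g \<otimes>\<^bsub>QG\<^esub> h \<in> ?N"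
    proof (intro CollectI conjI allI impI Lin_mult gL hL)
      fix v assume v: "unimod v"
      have "same_orbit (g (h v)) (h v)" "same_orbit (h v) v" using g h v Lin_unimod[OF hL v] by blast+
      then show "same_orbit ((g \<otimes>\<^bsub>QG\<^esub> h) v) v"
        unfolding Lin_apply[OF gL hL unimod_closed[OF v]] by (rule same_orbit_trans)
    qed
  qed
  have "x \<otimes>\<^bsub>QG\<^esub> g \<otimes>\<^bsub>QG\<^esub> inv\<^bsub>QG\<^esub> x \<in> ?N" if x: "x \<in> Lin" and g: "g \<in> ?N" for x g
  proof (intro CollectI conjI allI impI Lin_mult Lin_inv x)
    show gL: "g \<in> Lin" using g by blast
    fix v assume v: "unimod v"
    let ?w = "(inv\<^bsub>QG\<^esub> x) v"
    have w: "unimod ?w" by (rule Lin_unimod[OF Lin_inv[OF x] v])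
    have "same_orbit (g ?w) ?w" using g w by blast
    from Lin_same_orbit[OF x w this]
    show "same_orbit ((x \<otimes>\<^bsub>QG\<^esub> g \<otimes>\<^bsub>QG\<^esub> inv\<^bsub>QG\<^esub> x) v) v"
      unfolding Lin_conj_apply[OF x gL unimod_closed[OF v]] Lin_inv_apply(2)[OF x unimod_closed[OF v]] .
  qed
  then have normal: "?N \<lhd> (QG\<lparr>carrier := Lin\<rparr>)"
    by (intro QG.normal_in_subgroupI[OF Lin_subgroup N]) auto
  have "same_orbit (\<epsilon> c q v) v \<and> same_orbit (\<delta> c q v) v" if "c \<in> I" "q \<in> IP" "unimod v" for c q v
  proof -
    have "pcong q \<zero>\<^bsub>P\<^esub>" "cong c \<zero>"
      using that IP_closed(1) by (auto simp: pcong_zero_iff cong_zero_iff Icarr)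
    then show ?thesis
      using same_orbit_lin[OF same_orbit_refl[OF unimod_closed[OF that(3)]] that(3), of c \<zero> q "\<zero>\<^bsub>P\<^esub>"]
      by (simp only: lin_zero unimod_closed[OF that(3)])
  qed
  then have trivial: "\<forall>v. unimod v \<longrightarrow> same_orbit (s v) v" if "s \<in> lin_gens I IP" for s
    using that unfolding lin_gens_def by blast
  have "lin_gens I IP \<subseteq> Lin"
    unfolding Lin_generated by (rule subsetI, rule generate.incl, rule subsetD[OF lin_gens_mono])
  with trivial have "lin_gens I IP \<subseteq> ?N" by blast
  then have "ETrans_ideal R M I \<subseteq> ?N"
    unfolding ETrans_ideal_generated using N by (rule QG.generate_subgroup_incl)
  then have "LinI \<subseteq> ?N"
    unfolding ETrans_rel_def sum_module_M using normal by (intro QG.normal_closure_least)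
  then show ?thesis using assms by blast
qed

lemma unimodular_imp_unimod:
  assumes "unimodular R Q v" shows "unimod v"
proof -
  obtain f where v: "v \<in> carrier Q" and f: "f \<in> carrier (dual_module R Q)" and fv: "f v = \<one>"
    using assms unfolding unimodular_def by blast
  obtain a b p where abp: "v = (a, b, p)" "a \<in> carrier R" "b \<in> carrier R" "p \<in> carrier P"
    using v by (cases v) simp
  note f' = f[unfolded in_dual_module_iff]
  have Q: "Q = sum_module (self_module R) M" by (simp only: sum_module_M)
  have add: "f ((a, m) \<oplus>\<^bsub>Q\<^esub> (a', m')) = f (a, m) \<oplus> f (a', m')"
    if "(a, m) \<in> carrier Q" "(a', m') \<in> carrier Q" for a m a' m'
    using f' that by blast
  have smult: "f (c \<odot>\<^bsub>Q\<^esub> u) = c \<otimes> f u" if "c \<in> carrier R" "u \<in> carrier Q" for c u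
    using f' that by blast
  have closed: "f u \<in> carrier R" if "u \<in> carrier Q" for u using f' that by blast
  interpret MM: module R M by (rule M_module)
  let ?\<tau> = "\<lambda>m\<in>carrier M. f (\<zero>, m)"
  have Q_add: "(a, m) \<oplus>\<^bsub>Q\<^esub> (a', m') = (a \<oplus> a', m \<oplus>\<^bsub>M\<^esub> m')" for a m a' m'
    unfolding Q by simp
  have Q_smult: "c \<odot>\<^bsub>Q\<^esub> (a, m) = (c \<otimes> a, c \<odot>\<^bsub>M\<^esub> m)" for c a m
    unfolding Q by simp
  have Q_in: "(a, m) \<in> carrier Q \<longleftrightarrow> a \<in> carrier R \<and> m \<in> carrier M" for a m
    unfolding Q by simp
  have "?\<tau> \<in> carrier (dual_module R M)"
    unfolding in_dual_module_iff
  proof (intro conjI ballI)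
    fix m m' assume m: "m \<in> carrier M" "m' \<in> carrier M"
    show "?\<tau> (m \<oplus>\<^bsub>M\<^esub> m') = ?\<tau> m \<oplus> ?\<tau> m'"
      using add[of \<zero> m \<zero> m'] m by (simp only: Q_add Q_in restrict_apply' MM.add.m_closed R.zero_closed R.l_zero simp_thms)
  next
    fix c m assume m: "c \<in> carrier R" "m \<in> carrier M"
    show "?\<tau> (c \<odot>\<^bsub>M\<^esub> m) = c \<otimes> ?\<tau> m"
      using smult[of c "(\<zero>, m)"] m by (simp only: Q_smult Q_in restrict_apply' MM.smult_closed R.zero_closed R.r_null simp_thms)
  qed (simp_all only: restrict_extensional restrict_apply' closed Q_in R.zero_closed simp_thms)
  then obtain \<beta> q where \<beta>q: "\<beta> \<in> carrier R" "q \<in> carrier P" "?\<tau> = functional \<beta> q"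
    by (rule dual_functional)
  let ?\<alpha> = "f (\<one>, \<zero>, \<zero>\<^bsub>P\<^esub>)"
  have \<alpha>: "?\<alpha> \<in> carrier R" by (rule closed) simp
  have bp: "f (\<zero>, b, p) = \<beta> \<otimes> b \<oplus> B p q"
    using fun_cong[OF \<beta>q(3), of "(b, p)"] abp by simp
  have "f (a, \<zero>, \<zero>\<^bsub>P\<^esub>) = a \<otimes> ?\<alpha>"
    using smult[of a "(\<one>, \<zero>, \<zero>\<^bsub>P\<^esub>)"] abp by (simp add: Q_smult)
  then have "f v = a \<otimes> ?\<alpha> \<oplus> (\<beta> \<otimes> b \<oplus> B p q)"
    using add[of a "(\<zero>, \<zero>\<^bsub>P\<^esub>)" \<zero> "(b, p)"] abp bp by (simp add: Q_add)
  then have "hyp_form v (\<ominus> \<beta>, ?\<alpha>, q) = \<one>"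
    using fv abp \<beta>q(1,2) \<alpha> by (simp add: R.minus_eq R.r_minus R.m_comm R.a_assoc form_closed)
  then show ?thesis unfolding unimod_def using v \<alpha> \<beta>q by (intro conjI bexI[of _ "(\<ominus> \<beta>, ?\<alpha>, q)"]) simp_all
qed

theorem orbits_coincide:
  assumes "unimodular R Q v" shows "{g v | g. g \<in> LinI} = {g v | g. g \<in> SpI}"
  using LinI_same_orbit[OF _ unimodular_imp_unimod[OF assms]] SpI_subset_LinI unfolding same_orbit_def by blast

end

theorem theorem6p1:
  fixes R :: "('a, 'r) ring_scheme" (structure)
    and P :: "('a, 'b, 'k) module_scheme"
    and B :: "'b \<Rightarrow> 'b \<Rightarrow> 'a"
    and I :: "'a set" and n :: nat and a b :: 'a and p :: 'b
  defines "Q \<equiv> hyp_module R P"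
  assumes "cring R"
    and "carrier R = {(\<one> \<oplus> \<one>) \<otimes> r | r. r \<in> carrier R}"
    and "ideal I R"
    and "n \<ge> 1"
    and "symplectic_module R P B"
    and "has_rank R P (2 * n)"
    and "(a, b, p) \<in> Um_rel R P I"
    and "\<And>\<mm>. maximalideal \<mm> R \<Longrightarrow> locally_standard_at R I P B n \<mm>"
  shows "orbit (BijGroup (carrier Q)\<lparr>carrier := ETrans_rel R (sum_module (self_module R) P) I\<rparr>)
           (\<lambda>g. g) (a, b, p) =
         orbit (BijGroup (carrier Q)\<lparr>carrier := ETransSp_rel R P B I\<rparr>) (\<lambda>g. g) (a, b, p)"
proof -
  interpret cring R by fact
  obtain h where h: "h \<in> carrier R" "(\<one> \<oplus> \<one>) \<otimes> h = \<one>"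
    using subsetD[OF equalityD1[OF assms(3)] one_closed] by auto
  have "relative_symplectic_half R P B I h"
    using assms(2,4,6) h
    by (intro relative_symplectic_half.intro relative_symplectic.intro relative.intro
        relative_symplectic_half_axioms.intro) (simp_all add: l_distr)
  then interpret relative_symplectic_half R P B I h .
  have "unimodular R (hyp_module R P) (a, b, p)" using assms(8) by (simp add: Um_rel_def)
  from orbits_coincide[OF this] show ?thesis by (simp add: orbit_def)
qed

end
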